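(* Let $n \ge 2$, let $S$ be the unit sphere in $\mathbb{R}^n$, let $0<\alpha\le n$ and $q>0$. Suppose that to every $\epsilon>0$ there is a constant $C_\epsilon$ such that $$\int_{B(0,R)} |Ef(x)|^q H(x)\, dx \leq C_\epsilon R^\epsilon A_\alpha(H) \| f \|_{L^2(S)}^q$$ for all functions $f \in L^2(S)$, weights $H$ on $\mathbb{R}^n$ of dimension $\alpha$, and radii $R \geq 1$. Then $$q \geq \left\{ \begin{array}{ll} 2 & \text{ if } n \geq 3 \text{ and } 0 < \alpha \leq n-2, \\ (2\alpha+2)/(n-1) & \text{ if } n \geq 3 \text{ and } n-2 < \alpha \leq n, \text{ or if } n=2 \text{ and } 1<\alpha\le 2, \\ 2 & \text{ if } n = 2 \text{ and } 0 < \alpha < 1/2, \\ 4 \alpha & \text{ if } n = 2 \text{ and } 1/2 \leq \alpha \leq 1. \end{array} \right.$$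
   Context: $\sigma$ denotes the surface area measure on $S$, $L^p(S)=L^p(\sigma)$, and the extension operator $E=E_S$ is $$Ef(x) = \widehat{f d\sigma}(x)=\int_S e^{-2 \pi i x \cdot \xi} f(\xi)\, d\sigma(\xi), \qquad f \in L^1(S).$$ For $0 < \alpha \leq n$ and a Lebesgue measurable function $H: \mathbb{R}^n \to [0,1]$, define $$A_\alpha(H)= \inf \Big\{ C : \int_{B(x_0,R)} H(x)\, dx \leq C R^\alpha \text{ for all } x_0 \in \mathbb{R}^n \text{ and } R \geq 1 \Big\},$$ where $B(x_0,R)$ is the closed ball of center $x_0$ and radius $R$. Such an $H$ is called a weight of dimension $\alpha$ if $A_\alpha(H) < \infty$. The constant $C_\epsilon$ in the hypothesis does not depend on $f$, $H$, or $R$. *)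

theory Defs
  imports "HOL-Analysis.Analysis"
begin

text \<open>
  Surface area measure on the unit sphere of \<open>\<real>\<^sup>n\<close>, normalised as in polar coordinates
  (\<open>dx = r\<^bsup>n - 1\<^esup> dr d\<sigma>\<close>): \<open>\<sigma>(A)\<close> is \<open>n\<close> times the Lebesgue measure of the cone
  \<open>{t \<xi> | 0 < t \<le> 1, \<xi> \<in> A}\<close>, see \<open>emeasure_sphere_measure\<close> below. Note that
  \<open>sgn x = x / |x|\<close>, and that the space of this measure is the sphere itself.
\<close>

definition sphere_measure :: "(real ^ 'n) measure" where
  "sphere_measure =
     scale_measure (of_nat CARD('n))
       (distr (restrict_space lborel (cball 0 1 - {0})) (restrict_space borel (sphere 0 1)) sgn)"

lemma space_sphere_measure [simp]: "space (sphere_measure :: (real ^ 'n) measure) = sphere 0 1"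
  by (simp add: sphere_measure_def space_scale_measure space_restrict_space)

lemma sets_sphere_measure [simp]:
  "sets (sphere_measure :: (real ^ 'n) measure) = sets (restrict_space borel (sphere 0 1))"
  by (simp add: sphere_measure_def)

lemma measurable_sgn_sphere:
  "sgn \<in> measurable (restrict_space lborel (cball 0 1 - {0}))
           (restrict_space borel (sphere 0 1 :: (real ^ 'n) set))"
proof (rule measurable_restrict_space2)
  show "sgn \<in> space (restrict_space lborel (cball 0 1 - {0 :: real ^ 'n})) \<rightarrow> sphere 0 1"
    by (auto simp: space_restrict_space norm_sgn)
  have "continuous_on (cball 0 1 - {0 :: real ^ 'n}) sgn"
    unfolding sgn_div_norm by (intro continuous_intros) auto
  hence "sgn \<in> borel_measurable (restrict_space borel (cball 0 1 - {0 :: real ^ 'n}))"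
    by (rule borel_measurable_continuous_on_restrict)
  thus "sgn \<in> borel_measurable (restrict_space lborel (cball 0 1 - {0 :: real ^ 'n}))"
    by (simp cong: measurable_cong_sets sets_restrict_space_cong)
qed

lemma emeasure_sphere_measure:
  fixes A :: "(real ^ 'n) set"
  assumes "A \<in> sets borel" "A \<subseteq> sphere 0 1"
  shows "emeasure sphere_measure A =
    of_nat CARD('n) * emeasure lborel {t *\<^sub>R \<xi> | t \<xi>. 0 < t \<and> t \<le> 1 \<and> \<xi> \<in> A}"
proof -
  let ?D = "cball 0 1 - {0 :: real ^ 'n}"
  have A: "A \<in> sets (restrict_space borel (sphere 0 1))"
    using assms by (auto simp: sets_restrict_space_iff)
  have eq: "sgn -` A \<inter> ?D = {t *\<^sub>R \<xi> | t \<xi>. 0 < t \<and> t \<le> 1 \<and> \<xi> \<in> A}" (is "?L = ?R")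
  proof (intro subset_antisym subsetI)
    fix x assume "x \<in> ?L"
    hence "x = norm x *\<^sub>R sgn x" "0 < norm x" "norm x \<le> 1" "sgn x \<in> A"
      by (auto simp: sgn_div_norm)
    thus "x \<in> ?R" by blast
  next
    fix x assume "x \<in> ?R"
    then obtain t \<xi> where *: "x = t *\<^sub>R \<xi>" "0 < t" "t \<le> 1" "\<xi> \<in> A" by blast
    with assms(2) have "norm \<xi> = 1" by auto
    with * show "x \<in> ?L" by (auto simp: sgn_div_norm)
  qed
  have "emeasure sphere_measure A =
      of_nat CARD('n) * emeasure (restrict_space lborel ?D) (sgn -` A \<inter> ?D)"
    unfolding sphere_measure_def emeasure_scale_measure
    by (subst emeasure_distr[OF measurable_sgn_sphere A]) (simp add: space_restrict_space)
  also have "emeasure (restrict_space lborel ?D) (sgn -` A \<inter> ?D) = emeasure lborel (sgn -` A \<inter> ?D)"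
    by (rule emeasure_restrict_space) auto
  finally show ?thesis by (simp only: eq)
qed

definition L2_sphere :: "(real ^ 'n \<Rightarrow> complex) set" where
  "L2_sphere = {f \<in> borel_measurable sphere_measure.
     integrable sphere_measure (\<lambda>\<xi>. (norm (f \<xi>))\<^sup>2)}"

definition norm_L2_sphere :: "(real ^ 'n \<Rightarrow> complex) \<Rightarrow> real" where
  "norm_L2_sphere f = sqrt (\<integral>\<xi>. (norm (f \<xi>))\<^sup>2 \<partial>sphere_measure)"

definition extension_op :: "(real ^ 'n \<Rightarrow> complex) \<Rightarrow> real ^ 'n \<Rightarrow> complex" where
  "extension_op f x =
     (\<integral>\<xi>. exp (- 2 * complex_of_real pi * \<i> * complex_of_real (x \<bullet> \<xi>)) * f \<xi> \<partial>sphere_measure)"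

text \<open>
  The infimum is taken in \<open>[0,\<infinity>]\<close>, so that it is \<open>\<infinity>\<close> exactly when no finite \<open>C\<close> is admissible.
\<close>

definition A_dim :: "real \<Rightarrow> (real ^ 'n \<Rightarrow> real) \<Rightarrow> ennreal" where
  "A_dim \<alpha> H = Inf {C. \<forall>x\<^sub>0 R. R \<ge> 1 \<longrightarrow>
     (\<integral>\<^sup>+x\<in>cball x\<^sub>0 R. ennreal (H x) \<partial>lebesgue) \<le> C * ennreal (R powr \<alpha>)}"

definition weight_of_dim :: "real \<Rightarrow> (real ^ 'n \<Rightarrow> real) \<Rightarrow> bool" where
  "weight_of_dim \<alpha> H \<longleftrightarrow>
     H \<in> borel_measurable lebesgue \<and> (\<forall>x. 0 \<le> H x \<and> H x \<le> 1) \<and> A_dim \<alpha> H < \<infinity>"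

end

(*
  Two families of examples. (1) Knapp: let f be the indicator of a cap of radius R^(-1/2); then |Ef| is
  comparable to the measure R^(-(n-1)/2) of the cap on a tube of length R and width R^(1/2). The constant
  weight R^(-(n-alpha)/2) (if alpha >= 1) or R^(alpha-(n+1)/2) (if alpha <= 1) on the tube has bounded
  A_alpha, and the estimate gives q >= 2(alpha+1)/(n-1), respectively q >= 4 alpha/(n-1).
  (2) Random signs: let H be the indicator of N unit-size balls around points x_j that are so sparse that
  A_alpha(H) is bounded while all of them lie in a ball of radius a power of N, and let f be a random
  signed sum of the characters exp(2 pi i x_j . xi). On average |f|^2 is N, and |Ef|^q is bounded below
  on the balls, since conditionally on the other signs one sign of the j-th term makes |Ef| large near
  x_j; no decay of the Fourier transform of the surface measure is needed. Hence N <= C N^(q/2 + eps'),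
  so q >= 2 for every alpha > 0.
*)
theory Submission imports Defs begin

section \<open>Comparison of exponents and averages over signs\<close>

text \<open>If \<open>a\<close> exceeded \<open>b\<close>, then \<open>N powr (a - b)\<close> would
  be unbounded, yet it stays below \<open>K\<close>. This converts an inequality at all scales into
  one between exponents; \<open>K\<close> may depend on everything except \<open>N\<close>.\<close>

lemma powr_le_powr_imp_le:
  fixes a b K :: real
  assumes "\<And>N::nat. N \<ge> 1 \<Longrightarrow> real N powr a \<le> K * real N powr b"
  shows "a \<le> b"
proof (rule ccontr)
  assume "\<not> a \<le> b"
  then have d: "a - b > 0" by simp
  define N where "N = nat \<lceil>(\<bar>K\<bar> + 1) powr (1 / (a - b))\<rceil>"
  have N: "(\<bar>K\<bar> + 1) powr (1 / (a - b)) \<le> real N"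
    unfolding N_def by (rule real_nat_ceiling_ge)
  have "0 < (\<bar>K\<bar> + 1) powr (1 / (a - b))" by (simp add: add_nonneg_pos)
  with N have "N \<ge> 1" by linarith
  have "\<bar>K\<bar> + 1 = ((\<bar>K\<bar> + 1) powr (1 / (a - b))) powr (a - b)"
    using d by (simp add: powr_powr)
  also have "\<dots> \<le> real N powr (a - b)"
    using N d by (intro powr_mono2) auto
  finally have "K < real N powr (a - b)" by linarith
  then have "K * real N powr b < real N powr (a - b) * real N powr b"
    using \<open>N \<ge> 1\<close> by simp
  with assms[OF \<open>N \<ge> 1\<close>] show False by (simp flip: powr_add)
qed

lemma sum_Pow_insert:
  fixes h :: "'a set \<Rightarrow> 'b::comm_monoid_add"
  assumes "finite J" "i \<notin> J"
  shows "(\<Sum>A\<in>Pow (insert i J). h A) = (\<Sum>A\<in>Pow J. h A + h (insert i A))"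
proof -
  have "inj_on (insert i) (Pow J)"
    using assms(2) by (auto simp: inj_on_def)
  moreover have "Pow J \<inter> insert i ` Pow J = {}"
    using assms(2) by auto
  ultimately show ?thesis
    using assms(1) by (simp add: Pow_insert sum.union_disjoint sum.reindex sum.distrib)
qed

text \<open>A choice of signs is encoded as the set \<open>A\<close> of indices with sign plus. An
  average over random signs is then a finite sum over \<open>Pow I\<close>, and no probability space
  enters.\<close>

definition signed_sum :: "'a set \<Rightarrow> 'a set \<Rightarrow> ('a \<Rightarrow> complex) \<Rightarrow> complex" where
  "signed_sum I A z = (\<Sum>j\<in>I. (if j \<in> A then z j else - z j))"

lemma signed_sum_insert:
  assumes "finite J" "i \<notin> J" "A \<subseteq> J"
  shows "signed_sum (insert i J) A z = signed_sum J A z - z i"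
    and "signed_sum (insert i J) (insert i A) z = signed_sum J A z + z i"
proof -
  have "i \<notin> A" using assms by auto
  moreover have "signed_sum J (insert i A) z = signed_sum J A z"
    unfolding signed_sum_def using assms by (intro sum.cong) auto
  ultimately show "signed_sum (insert i J) A z = signed_sum J A z - z i"
    and "signed_sum (insert i J) (insert i A) z = signed_sum J A z + z i"
    using assms by (simp_all add: signed_sum_def)
qed

text \<open>The cross terms cancel over the signs: by the parallelogram identity, the two signs of a
  new index \<open>i\<close> contribute twice the old square plus twice the square of
  \<open>norm (z i)\<close>.\<close>

lemma sum_norm_signed_sum_sq:
  assumes "finite I"
  shows "(\<Sum>A\<in>Pow I. (norm (signed_sum I A z))\<^sup>2) = 2 ^ card I * (\<Sum>j\<in>I. (norm (z j))\<^sup>2)"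
  using assms
proof induction
  case (insert i J)
  have "(\<Sum>A\<in>Pow (insert i J). (norm (signed_sum (insert i J) A z))\<^sup>2)
      = (\<Sum>A\<in>Pow J. (norm (signed_sum J A z - z i))\<^sup>2 + (norm (signed_sum J A z + z i))\<^sup>2)"
    unfolding sum_Pow_insert[OF insert.hyps] using insert.hyps
    by (intro sum.cong) (auto simp: signed_sum_insert)
  also have "\<dots> = (\<Sum>A\<in>Pow J. 2 * (norm (signed_sum J A z))\<^sup>2 + 2 * (norm (z i))\<^sup>2)"
    by (intro sum.cong) (simp_all add: cmod_power2, simp_all add: power2_eq_square algebra_simps)
  also have "\<dots> = 2 * (\<Sum>A\<in>Pow J. (norm (signed_sum J A z))\<^sup>2) + 2 ^ card J * (2 * (norm (z i))\<^sup>2)"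
    using insert.hyps by (simp add: sum.distrib card_Pow sum_distrib_left)
  finally show ?case
    using insert by (simp add: algebra_simps)
qed (simp add: signed_sum_def)

text \<open>For each choice of the other signs, one of the two signs of \<open>z i\<close> yields a sum of modulus
  at least \<open>|z i|\<close>.\<close>

lemma sum_norm_signed_sum_powr_ge:
  fixes q :: real
  assumes "finite I" "i \<in> I" "q > 0"
  shows "2 ^ card I * (norm (z i) powr q / 2) \<le> (\<Sum>A\<in>Pow I. norm (signed_sum I A z) powr q)"
proof -
  define J where "J = I - {i}"
  have J: "finite J" "i \<notin> J" "I = insert i J"
    using assms by (auto simp: J_def)
  have *: "norm (z i) powr q \<le> norm (w - z i) powr q + norm (w + z i) powr q" for w
  proof -
    have "2 * norm (z i) = norm ((w + z i) - (w - z i))"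
      by (simp add: norm_mult flip: mult_2)
    also have "\<dots> \<le> norm (w + z i) + norm (w - z i)"
      by (rule norm_triangle_ineq4)
    finally have "norm (z i) \<le> norm (w - z i) \<or> norm (z i) \<le> norm (w + z i)"
      by linarith
    then have "norm (z i) powr q \<le> norm (w - z i) powr q \<or> norm (z i) powr q \<le> norm (w + z i) powr q"
      using assms(3) by (auto intro: powr_mono2)
    then show ?thesis
      using powr_ge_zero[of "norm (w - z i)" q] powr_ge_zero[of "norm (w + z i)" q] by linarith
  qed
  have "2 ^ card I * (norm (z i) powr q / 2) = (\<Sum>A\<in>Pow J. norm (z i) powr q)"
    using J by (simp add: card_Pow)
  also have "\<dots> \<le> (\<Sum>A\<in>Pow J. norm (signed_sum J A z - z i) powr q + norm (signed_sum J A z + z i) powr q)"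
    by (intro sum_mono *)
  also have "\<dots> = (\<Sum>A\<in>Pow I. norm (signed_sum I A z) powr q)"
    unfolding J(3) sum_Pow_insert[OF J(1,2)] using J
    by (intro sum.cong) (auto simp: signed_sum_insert)
  finally show ?thesis .
qed

section \<open>Boxes, surface measure, extension of indicators and constant weights\<close>

text \<open>A common form for the boxes used below: inside the cone over a cap, the tube itself, and
  the boxes enclosing the part of the tube in a ball.\<close>

lemma emeasure_cbox_axis:
  fixes a b :: "real ^ 'n"
  assumes "b $ k - a $ k = u" "\<And>j. j \<noteq> k \<Longrightarrow> b $ j - a $ j = v" "u \<ge> 0" "v \<ge> 0"
  shows "emeasure lborel (cbox a b) = ennreal (u * v ^ (CARD('n) - 1))"
proof -
  have le: "a $ j \<le> b $ j" for j
    using assms by (cases "j = k") force+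
  have "measure lborel (cbox a b) = (\<Prod>j\<in>UNIV. b $ j - a $ j)"
    using le by (intro content_cbox_cart) (simp add: interval_ne_empty_cart)
  also have "\<dots> = (b $ k - a $ k) * (\<Prod>j\<in>UNIV - {k}. b $ j - a $ j)"
    by (rule prod.remove) auto
  also have "(\<Prod>j\<in>UNIV - {k}. b $ j - a $ j) = (\<Prod>j\<in>UNIV - {k}. v)"
    using assms(2) by (intro prod.cong) auto
  finally show ?thesis
    using assms(1) by (simp add: emeasure_eq_measure2 card_Diff_singleton)
qed

lemma finite_measure_sphere: "finite_measure (sphere_measure :: (real ^ 'n) measure)"
proof
  have "emeasure (sphere_measure :: (real ^ 'n) measure) (sphere 0 1)
      \<le> of_nat CARD('n) * emeasure lborel (cball 0 1 :: (real ^ 'n) set)"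
    by (subst emeasure_sphere_measure) (auto intro!: mult_left_mono emeasure_mono)
  also have "\<dots> < \<infinity>"
    using emeasure_lborel_cball_finite[of "0 :: real ^ 'n" 1] by (simp add: ennreal_mult_less_top of_nat_less_top)
  finally show "emeasure (sphere_measure :: (real ^ 'n) measure) (space sphere_measure) \<noteq> \<infinity>"
    by simp
qed

interpretation sphere: finite_measure "sphere_measure :: (real ^ 'n) measure"
  by (rule finite_measure_sphere)

lemma borel_measurable_sphere [measurable (raw)]:
  fixes f :: "real ^ 'n \<Rightarrow> 'b::topological_space"
  assumes "f \<in> borel_measurable borel"
  shows "f \<in> borel_measurable sphere_measure"
proof -
  have "f \<in> borel_measurable (restrict_space borel (sphere 0 1))"
    using assms by (rule measurable_restrict_space1)
  then show ?thesis
    by (simp cong: measurable_cong_sets)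
qed

lemma borel_measurable_extension_op:
  assumes [measurable]: "f \<in> borel_measurable sphere_measure"
  shows "extension_op f \<in> borel_measurable (borel :: (real ^ 'n) measure)"
proof -
  have [measurable]: "(\<lambda>\<xi>::real^'n. \<xi>) \<in> borel_measurable sphere_measure"
    by (rule borel_measurable_sphere) simp
  show ?thesis
    unfolding extension_op_def
    by (rule sphere.borel_measurable_lebesgue_integral) measurable
qed

lemma bounded_in_L2_sphere:
  assumes [measurable]: "f \<in> borel_measurable borel" and "\<And>\<xi>. norm (f \<xi>) \<le> B"
  shows "f \<in> L2_sphere"
  unfolding L2_sphere_def
proof safe
  show m: "f \<in> borel_measurable sphere_measure"
    by measurable
  show "integrable sphere_measure (\<lambda>\<xi>. (norm (f \<xi>))\<^sup>2)"
    using m assms(2) by (intro sphere.integrable_const_bound[of _ "B\<^sup>2"]) (auto intro!: power_mono)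
qed

lemma integrable_oscillating:
  fixes x :: "real ^ 'n"
  assumes [measurable]: "f \<in> borel_measurable borel" and "\<And>\<xi>. norm (f \<xi>) \<le> B"
  shows "integrable sphere_measure
    (\<lambda>\<xi>. exp (- 2 * complex_of_real pi * \<i> * complex_of_real (x \<bullet> \<xi>)) * f \<xi>)"
proof (rule sphere.integrable_const_bound[of _ B])
  show "(\<lambda>\<xi>. exp (- 2 * complex_of_real pi * \<i> * complex_of_real (x \<bullet> \<xi>)) * f \<xi>)
    \<in> borel_measurable sphere_measure"
    by (rule borel_measurable_sphere) measurable
qed (use assms(2) in \<open>simp add: norm_mult norm_exp_eq_Re\<close>)

text \<open>The angle is at most pi/3 in modulus; this is the origin of the threshold 1/6 for
  phases.\<close>

lemma cos_ge_half:
  assumes "\<bar>t\<bar> \<le> 1 / 6"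
  shows "cos (2 * pi * t) \<ge> 1 / 2"
proof -
  have "cos (pi / 3) \<le> cos \<bar>2 * pi * t\<bar>"
    using assms by (intro cos_monotone_0_pi_le) (auto simp: abs_mult field_simps)
  then show ?thesis by (simp add: cos_60)
qed

text \<open>There is no cancellation: after multiplication by the unimodular number with phase
  \<open>x \<bullet> e\<close>, the real part of the integrand is at least 1/2 on \<open>U\<close>.
  It serves with \<open>e\<close> the pole of a cap, and with \<open>e = 0\<close> for the whole
  sphere and small \<open>x\<close>.\<close>

lemma norm_extension_op_indicator_ge:
  fixes U :: "(real ^ 'n) set"
  assumes [measurable]: "U \<in> sets borel" and "U \<subseteq> sphere 0 1"
    and small: "\<And>\<xi>. \<xi> \<in> U \<Longrightarrow> \<bar>x \<bullet> (\<xi> - e)\<bar> \<le> 1 / 6"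
  shows "norm (extension_op (indicator U) x) \<ge> measure sphere_measure U / 2"
proof -
  define g where "g = (\<lambda>\<xi>. exp (- 2 * complex_of_real pi * \<i> * complex_of_real (x \<bullet> \<xi>)) * indicator U \<xi>)"
  define c where "c = exp (2 * complex_of_real pi * \<i> * complex_of_real (x \<bullet> e))"
  have int: "integrable sphere_measure g"
    unfolding g_def by (rule integrable_oscillating[of _ 1]) (auto simp: indicator_def)
  have U: "U \<in> sets (sphere_measure :: (real ^ 'n) measure)"
    using assms by (auto simp: sets_restrict_space_iff)
  have Re: "Re (c * g \<xi>) = cos (2 * pi * (x \<bullet> (\<xi> - e))) * indicator U \<xi>" for \<xi>
    by (auto simp: c_def g_def indicator_def Re_exp inner_diff_right algebra_simps cos_diff
      simp flip: exp_add)
  have "measure sphere_measure U / 2 = (\<integral>\<xi>. indicator U \<xi> / 2 \<partial>sphere_measure)"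
    using assms(2) by (simp add: Int_absorb2)
  also have "\<dots> \<le> (\<integral>\<xi>. Re (c * g \<xi>) \<partial>sphere_measure)"
  proof (rule integral_mono)
    show "integrable sphere_measure (\<lambda>\<xi>. indicator U \<xi> / 2 :: real)"
      using U by (intro integrable_divide integrable_real_indicator)
        (auto simp: sphere.emeasure_finite simp flip: less_top)
    show "integrable sphere_measure (\<lambda>\<xi>. Re (c * g \<xi>))"
      using int by (intro integrable_Re integrable_mult_right)
    show "indicator U \<xi> / 2 \<le> Re (c * g \<xi>)" for \<xi>
      using cos_ge_half[OF small[of \<xi>]] unfolding Re by (auto simp: indicator_def)
  qed
  also have "\<dots> = Re (\<integral>\<xi>. c * g \<xi> \<partial>sphere_measure)"
    by (intro integral_Re integrable_mult_right int)
  also have "\<dots> = Re (c * extension_op (indicator U) x)"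
    unfolding extension_op_def g_def by (subst integral_mult_right_zero) simp
  also have "\<dots> \<le> norm (c * extension_op (indicator U) x)"
    by (rule complex_Re_le_cmod)
  also have "\<dots> = norm (extension_op (indicator U) x)"
    by (simp add: norm_mult c_def norm_exp_eq_Re)
  finally show ?thesis .
qed

lemma norm_L2_sphere_indicator:
  fixes U :: "(real ^ 'n) set"
  assumes "U \<in> sets borel" and "U \<subseteq> sphere 0 1"
  shows "norm_L2_sphere (indicator U) = sqrt (measure sphere_measure U)"
proof -
  have "(norm (indicator U \<xi> :: complex))\<^sup>2 = indicator U \<xi>" for \<xi> :: "real ^ 'n"
    by (simp add: indicator_def)
  then show ?thesis
    using assms(2) by (simp add: norm_L2_sphere_def Int_absorb2)
qed


text \<open>All test weights are a constant times an indicator. For these, \<open>D\<close> is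
  admissible in the infimum as soon as the measure of \<open>T\<close> in balls of radius at least 1
  is controlled.\<close>

lemma weight_const_on:
  fixes T :: "(real ^ 'n) set"
  assumes [measurable]: "T \<in> sets borel" and c: "0 \<le> c" "c \<le> 1"
    and dim: "\<And>x\<^sub>0 r. r \<ge> 1 \<Longrightarrow> ennreal c * emeasure lborel (T \<inter> cball x\<^sub>0 r) \<le> ennreal D * ennreal (r powr \<alpha>)"
  shows "A_dim \<alpha> (\<lambda>x. c * indicator T x) \<le> ennreal D"
    and "weight_of_dim \<alpha> (\<lambda>x. c * indicator T x)"
proof -
  have "(\<integral>\<^sup>+x\<in>cball x\<^sub>0 r. ennreal (c * indicator T x) \<partial>lebesgue)
      = ennreal c * emeasure lborel (T \<inter> cball x\<^sub>0 r)" for x\<^sub>0 r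
  proof -
    have "(\<integral>\<^sup>+x\<in>cball x\<^sub>0 r. ennreal (c * indicator T x) \<partial>lebesgue)
        = (\<integral>\<^sup>+x. ennreal c * indicator (T \<inter> cball x\<^sub>0 r) x \<partial>lborel)"
      unfolding nn_integral_completion by (intro nn_integral_cong) (auto simp: indicator_def)
    then show ?thesis by (simp add: nn_integral_cmult_indicator)
  qed
  with dim show A: "A_dim \<alpha> (\<lambda>x. c * indicator T x) \<le> ennreal D"
    unfolding A_dim_def by (intro Inf_lower) simp
  have "(\<lambda>x. c * indicator T x) \<in> borel_measurable lebesgue"
    by (intro borel_measurable_times borel_measurable_const borel_measurable_indicator) auto
  moreover have "0 \<le> c * indicator T x \<and> c * indicator T x \<le> 1" for x
    using c by (auto simp: indicator_def)
  moreover have "A_dim \<alpha> (\<lambda>x. c * indicator T x) < \<infinity>"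
    using A by (simp add: le_less_trans[OF _ ennreal_less_top])
  ultimately show "weight_of_dim \<alpha> (\<lambda>x. c * indicator T x)"
    by (simp add: weight_of_dim_def)
qed

section \<open>Spherical caps: their measure and the phase on them\<close>

text \<open>The cap about the pole \<open>axis k 1\<close> is cut out by slopes rather than by
  distance. The slope condition is homogeneous, so it can be checked on \<open>z\<close> instead of
  \<open>sgn z\<close>, which makes the cone over the cap explicit.\<close>

definition cap :: "'n \<Rightarrow> real \<Rightarrow> (real ^ 'n) set" where
  "cap k \<rho> = {\<xi> \<in> sphere 0 1. \<xi> $ k > 0 \<and> (\<forall>j. j \<noteq> k \<longrightarrow> \<bar>\<xi> $ j\<bar> \<le> \<rho> * \<xi> $ k)}"

lemma cap_subset_sphere: "cap k \<rho> \<subseteq> sphere 0 1"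
  by (auto simp: cap_def)

lemma borel_cap [measurable]: "cap k \<rho> \<in> sets borel"
proof -
  have "(\<lambda>\<xi>. \<xi> $ j) \<in> borel_measurable (borel :: (real ^ 'n) measure)" for j
    by (intro borel_measurable_continuous_onI continuous_intros)
  note [measurable] = this
  have "cap k \<rho> = sphere 0 1 \<inter> {\<xi> \<in> space borel. \<xi> $ k > 0 \<and> (\<forall>j. j \<noteq> k \<longrightarrow> \<bar>\<xi> $ j\<bar> \<le> \<rho> * \<xi> $ k)}"
    by (auto simp: cap_def)
  also have "\<dots> \<in> sets borel"
    by (intro sets.Int) (simp, measurable)
  finally show ?thesis .
qed

text \<open>The cone over the cap contains the box \<open>1/4 \<le> z\<^sub>k \<le> 1/2\<close>, \<open>|z\<^sub>j| \<le> \<rho> / (4 n)\<close> for \<open>j \<noteq> k\<close>.\<close>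

lemma measure_cap_ge:
  fixes k :: "'n::finite"
  assumes "0 < \<rho>" "\<rho> \<le> 1"
  shows "measure sphere_measure (cap k \<rho>) \<ge> real CARD('n) / 4 * (\<rho> / (2 * real CARD('n))) ^ (CARD('n) - 1)"
proof -
  let ?n = "real CARD('n)"
  have n: "?n \<ge> 1" using zero_less_card_finite[where 'a='n] by linarith
  \<comment> \<open>The transverse half-width keeps the l1 norm below 1/2 +
    \<open>\<rho> / 4\<close>, hence the box in the unit ball; as the height is at least 1/4, all
    slopes are at most \<open>\<rho>\<close>.\<close>
  define a b :: "real ^ 'n" where
    "a = (\<chi> j. if j = k then 1 / 4 else - \<rho> / (4 * ?n))" and
    "b = (\<chi> j. if j = k then 1 / 2 else \<rho> / (4 * ?n))"
  let ?D = "cball 0 1 - {0 :: real ^ 'n}"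
  have sub: "cbox a b \<subseteq> sgn -` cap k \<rho> \<inter> ?D"
  proof
    fix z assume "z \<in> cbox a b"
    then have z: "a $ j \<le> z $ j" "z $ j \<le> b $ j" for j
      by (auto simp: mem_box_cart)
    have zk: "1 / 4 \<le> z $ k" "z $ k \<le> 1 / 2"
      using z[of k] by (auto simp: a_def b_def)
    have zj: "\<bar>z $ j\<bar> \<le> \<rho> / (4 * ?n)" if "j \<noteq> k" for j
      using z[of j] that by (auto simp: a_def b_def)
    have "norm z \<le> (\<Sum>j\<in>UNIV. \<bar>z $ j\<bar>)"
      by (rule norm_le_l1_cart)
    also have "\<dots> = \<bar>z $ k\<bar> + (\<Sum>j\<in>UNIV - {k}. \<bar>z $ j\<bar>)"
      by (rule sum.remove) auto
    also have "\<dots> \<le> 1 / 2 + (\<Sum>j\<in>UNIV - {k}. \<rho> / (4 * ?n))"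
      using zk zj by (intro add_mono sum_mono) auto
    also have "\<dots> \<le> 1 / 2 + ?n * (\<rho> / (4 * ?n))"
      using assms unfolding sum_constant by (intro add_left_mono mult_right_mono) (auto simp: card_Diff_singleton)
    also have "\<dots> \<le> 1" using n assms by simp
    finally have "norm z \<le> 1" .
    moreover have "z \<noteq> 0" using zk by auto
    moreover have "sgn z \<in> cap k \<rho>"
    proof -
      have "\<bar>z $ j\<bar> \<le> \<rho> * z $ k" if "j \<noteq> k" for j
      proof -
        have "\<bar>z $ j\<bar> \<le> \<rho> * (1 / 4 / ?n)" using zj[OF that] by simp
        also have "\<dots> \<le> \<rho> * (1 / 4)"
          using n assms by (intro mult_left_mono) (auto simp: field_simps)
        also have "\<dots> \<le> \<rho> * z $ k" using zk assms by simp
        finally show ?thesis .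
      qed
      then show ?thesis
        using zk \<open>z \<noteq> 0\<close> by (auto simp: cap_def norm_sgn sgn_div_norm abs_mult
          intro!: mult_left_mono divide_right_mono)
    qed
    ultimately show "z \<in> sgn -` cap k \<rho> \<inter> ?D" by simp
  qed
  have cap: "cap k \<rho> \<in> sets (restrict_space borel (sphere 0 1))"
    using borel_cap[of k \<rho>] cap_subset_sphere[of k \<rho>] by (auto simp: sets_restrict_space_iff)
  have "emeasure lborel (cbox a b) \<le> emeasure lborel (sgn -` cap k \<rho> \<inter> ?D)"
    using measurable_sets[OF measurable_sgn_sphere cap]
    by (intro emeasure_mono[OF sub]) (simp add: space_restrict_space sets_restrict_space_iff)
  also have "\<dots> = emeasure (restrict_space lborel ?D) (sgn -` cap k \<rho> \<inter> ?D)"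
    by (rule emeasure_restrict_space[symmetric]) auto
  finally have "of_nat CARD('n) * emeasure lborel (cbox a b) \<le> emeasure sphere_measure (cap k \<rho>)"
    unfolding sphere_measure_def emeasure_scale_measure emeasure_distr[OF measurable_sgn_sphere cap]
    by (simp add: space_restrict_space mult_left_mono)
  also have "emeasure lborel (cbox a b) = ennreal (1 / 4 * (\<rho> / (2 * ?n)) ^ (CARD('n) - 1))"
    using assms by (intro emeasure_cbox_axis[where k=k]) (auto simp: a_def b_def)
  finally have "ennreal (?n * (1 / 4 * (\<rho> / (2 * ?n)) ^ (CARD('n) - 1)))
      \<le> ennreal (measure sphere_measure (cap k \<rho>))"
    using assms by (simp add: sphere.emeasure_eq_measure ennreal_of_nat_eq_real_of_nat flip: ennreal_mult')
  then have "?n * (1 / 4 * (\<rho> / (2 * ?n)) ^ (CARD('n) - 1)) \<le> measure sphere_measure (cap k \<rho>)"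
    by (rule ennreal_le_iff[THEN iffD1, rotated]) simp
  then show ?thesis by (simp add: mult_ac)
qed

text \<open>The direction \<open>k\<close> may be longer by a factor \<open>1/\<rho>\<close> because
  \<open>1 - \<xi>\<^sub>k \<le> 1 - \<xi>\<^sub>k\<^sup>2 = O(\<rho>\<^sup>2)\<close> on the cap.\<close>

lemma cap_phase:
  fixes x :: "real ^ 'n"
  assumes \<xi>: "\<xi> \<in> cap k \<rho>" and "0 < \<rho>"
    and xk: "\<bar>x $ k\<bar> * \<rho>\<^sup>2 \<le> 1 / (12 * real CARD('n))"
    and xj: "\<And>j. j \<noteq> k \<Longrightarrow> \<bar>x $ j\<bar> * \<rho> \<le> 1 / (12 * real CARD('n))"
  shows "\<bar>x \<bullet> (\<xi> - axis k 1)\<bar> \<le> 1 / 6"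
proof -
  let ?n = "real CARD('n)"
  have n: "?n \<ge> 1" using zero_less_card_finite[where 'a='n] by linarith
  have n1: "real (card (UNIV - {k})) \<le> ?n" by (simp add: card_Diff_singleton)
  have pos: "0 < \<xi> $ k" and "norm \<xi> = 1" and \<xi>j: "\<And>j. j \<noteq> k \<Longrightarrow> \<bar>\<xi> $ j\<bar> \<le> \<rho> * \<xi> $ k"
    using \<xi> by (auto simp: cap_def)
  have le1: "\<xi> $ k \<le> 1" using component_le_norm_cart[of \<xi> k] \<open>norm \<xi> = 1\<close> by simp
  have \<xi>j: "\<bar>\<xi> $ j\<bar> \<le> \<rho>" if "j \<noteq> k" for j
    using order_trans[OF \<xi>j[OF that] mult_left_mono[OF le1, of \<rho>]] \<open>0 < \<rho>\<close> by simp
  have "1 = (\<Sum>j\<in>UNIV. (\<xi> $ j)\<^sup>2)"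
    using \<open>norm \<xi> = 1\<close> by (simp add: norm_vec_def L2_set_def)
  also have "\<dots> = (\<xi> $ k)\<^sup>2 + (\<Sum>j\<in>UNIV - {k}. (\<xi> $ j)\<^sup>2)"
    by (rule sum.remove) auto
  also have "(\<Sum>j\<in>UNIV - {k}. (\<xi> $ j)\<^sup>2) \<le> (\<Sum>j\<in>UNIV - {k}. \<rho>\<^sup>2)"
    using \<xi>j \<open>0 < \<rho>\<close> by (intro sum_mono) (auto simp: abs_le_square_iff[symmetric])
  also have "\<dots> \<le> ?n * \<rho>\<^sup>2" using mult_right_mono[OF n1, of "\<rho>\<^sup>2"] by simp
  also have "(\<xi> $ k)\<^sup>2 \<le> \<xi> $ k"
    using pos le1 by (simp add: power2_eq_square mult_left_le)
  finally have d: "\<bar>\<xi> $ k - 1\<bar> \<le> ?n * \<rho>\<^sup>2" using le1 by linarith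
  \<comment> \<open>The component along \<open>k\<close> and the transverse ones together each
    contribute at most 1/12. Both estimates lose a factor \<open>n\<close>, whence the bound 1/(12
    n) in the hypotheses.\<close>
  have "x \<bullet> (\<xi> - axis k 1) = (\<Sum>j\<in>UNIV. x $ j * (\<xi> - axis k 1) $ j)"
    by (simp add: inner_vec_def)
  also have "\<dots> = x $ k * (\<xi> $ k - 1) + (\<Sum>j\<in>UNIV - {k}. x $ j * \<xi> $ j)"
    by (subst sum.remove[of _ k]) (auto simp: axis_def intro!: sum.cong)
  finally have "\<bar>x \<bullet> (\<xi> - axis k 1)\<bar> \<le> \<bar>x $ k * (\<xi> $ k - 1)\<bar> + (\<Sum>j\<in>UNIV - {k}. \<bar>x $ j * \<xi> $ j\<bar>)"
    by (simp only:) (rule order_trans[OF abs_triangle_ineq add_left_mono[OF sum_abs]])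
  also have "\<bar>x $ k * (\<xi> $ k - 1)\<bar> \<le> \<bar>x $ k\<bar> * (?n * \<rho>\<^sup>2)"
    unfolding abs_mult by (intro mult_left_mono d) auto
  also have "\<dots> \<le> 1 / 12" using mult_left_mono[OF xk, of ?n] n by (simp add: mult_ac)
  also have "(\<Sum>j\<in>UNIV - {k}. \<bar>x $ j * \<xi> $ j\<bar>) \<le> (\<Sum>j\<in>UNIV - {k}. 1 / (12 * ?n))"
  proof (intro sum_mono)
    fix j assume "j \<in> UNIV - {k}"
    then have j: "j \<noteq> k" by simp
    have "\<bar>x $ j * \<xi> $ j\<bar> \<le> \<bar>x $ j\<bar> * \<rho>"
      unfolding abs_mult by (intro mult_left_mono \<xi>j j) auto
    with xj[OF j] show "\<bar>x $ j * \<xi> $ j\<bar> \<le> 1 / (12 * ?n)" by linarith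
  qed
  also have "\<dots> \<le> ?n * (1 / (12 * ?n))" unfolding sum_constant by (intro mult_right_mono n1) auto
  also have "\<dots> = 1 / 12" using n by simp
  finally show ?thesis by simp
qed


section \<open>Power inequalities and the tubes dual to caps\<close>

lemma sqrt_power_eq_powr: "R > 0 \<Longrightarrow> sqrt R ^ m = R powr (real m / 2)"
  by (simp add: powr_half_sqrt[symmetric] powr_realpow[symmetric] powr_powr)

text \<open>A replacement for Jensen's inequality for the concave power \<open>q / 2\<close>. Up to
  the square root of \<open>M\<close> the first term suffices; beyond it,
  \<open>y powr (q - 2)\<close> is at most \<open>M powr (q / 2 - 1)\<close> because
  \<open>q - 2\<close> is nonpositive. Summation over signs then only involves second
  moments.\<close>

lemma powr_le_split:
  fixes y M q :: real
  assumes "0 \<le> y" "0 < M" "0 < q" "q \<le> 2"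
  shows "y powr q \<le> M powr (q / 2) + M powr (q / 2 - 1) * y\<^sup>2"
proof (cases "y \<le> M powr (1 / 2)")
  case True
  then have "y powr q \<le> (M powr (1 / 2)) powr q"
    using assms by (intro powr_mono2) auto
  then show ?thesis by (simp add: powr_powr add_increasing2)
next
  case False
  then have y: "M powr (1 / 2) < y" by simp
  then have "y > 0" using powr_ge_zero[of M "1 / 2"] by linarith
  have "y powr (q - 2) \<le> (M powr (1 / 2)) powr (q - 2)"
    using assms y by (intro powr_mono2') auto
  also have "\<dots> = M powr (q / 2 - 1)"
    by (simp add: powr_powr algebra_simps diff_divide_distrib)
  finally have "y powr (q - 2) * y\<^sup>2 \<le> M powr (q / 2 - 1) * y\<^sup>2"
    by (intro mult_right_mono) auto
  moreover have "y powr (q - 2) * y\<^sup>2 = y powr q"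
    using \<open>y > 0\<close> by (simp add: powr_diff)
  ultimately show ?thesis by (simp add: add_increasing)
qed

text \<open>The half-sides are the largest ones that \<open>cap_phase\<close> admits for the cap
  with \<open>\<rho> = 1 / sqrt R\<close>.\<close>

definition tube_corner :: "'n::finite \<Rightarrow> real \<Rightarrow> real ^ 'n" where
  "tube_corner k R = (\<chi> j. if j = k then R / (12 * real CARD('n)) else sqrt R / (12 * real CARD('n)))"

definition tube :: "'n::finite \<Rightarrow> real \<Rightarrow> (real ^ 'n) set" where
  "tube k R = cbox (- tube_corner k R) (tube_corner k R)"

lemma borel_tube [measurable]: "tube k R \<in> sets borel"
  by (simp add: tube_def)

lemma tube_component:
  fixes k :: "'n::finite"
  assumes "x \<in> tube k R"
  shows "\<bar>x $ k\<bar> \<le> R / (12 * real CARD('n))"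
    and "j \<noteq> k \<Longrightarrow> \<bar>x $ j\<bar> \<le> sqrt R / (12 * real CARD('n))"
proof -
  have "- (tube_corner k R $ i) \<le> x $ i \<and> x $ i \<le> tube_corner k R $ i" for i
    using assms by (simp add: tube_def mem_box_cart)
  from this[of k] this[of j] show "\<bar>x $ k\<bar> \<le> R / (12 * real CARD('n))"
    and "j \<noteq> k \<Longrightarrow> \<bar>x $ j\<bar> \<le> sqrt R / (12 * real CARD('n))"
    by (auto simp: tube_corner_def)
qed

lemma emeasure_tube:
  fixes k :: "'n::finite"
  assumes "R \<ge> 0"
  shows "emeasure lborel (tube k R)
    = ennreal (R / (6 * real CARD('n)) * (sqrt R / (6 * real CARD('n))) ^ (CARD('n) - 1))"
  unfolding tube_def using assms
  by (intro emeasure_cbox_axis[where k=k]) (auto simp: tube_corner_def)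

lemma tube_subset_cball:
  fixes k :: "'n::finite"
  assumes "R \<ge> 1"
  shows "tube k R \<subseteq> cball 0 R"
proof
  fix x assume x: "x \<in> tube k R"
  have "sqrt R \<le> R" using assms by (intro real_le_lsqrt) (auto simp: power2_eq_square mult_left_le)
  then have *: "sqrt R / (12 * real CARD('n)) \<le> R / (12 * real CARD('n))"
    by (intro divide_right_mono) auto
  have "norm x \<le> (\<Sum>j\<in>UNIV. \<bar>x $ j\<bar>)"
    by (rule norm_le_l1_cart)
  also have "\<dots> \<le> (\<Sum>j\<in>(UNIV :: 'n set). R / (12 * real CARD('n)))"
  proof (intro sum_mono)
    fix j show "\<bar>x $ j\<bar> \<le> R / (12 * real CARD('n))"
      using tube_component(1)[OF x] tube_component(2)[OF x, of j] * by (cases "j = k") auto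
  qed
  also have "\<dots> \<le> R" using assms by simp
  finally show "x \<in> cball 0 R" by simp
qed

text \<open>The three bounds come from a cube around the ball, from the tube cut to length
  \<open>2 * r\<close>, and from the whole tube. Up to constants they are the efficient ones for
  \<open>r\<close> below \<open>sqrt R\<close>, between \<open>sqrt R\<close> and \<open>R\<close>,
  and above \<open>R\<close>.\<close>

lemma emeasure_tube_Int_cball:
  fixes k :: "'n::finite"
  assumes "R \<ge> 1" "r \<ge> 1"
  shows "emeasure lborel (tube k R \<inter> cball x\<^sub>0 r) \<le> ennreal (2 * r * (2 * r) ^ (CARD('n) - 1))"
    and "emeasure lborel (tube k R \<inter> cball x\<^sub>0 r) \<le> ennreal (2 * r * sqrt R ^ (CARD('n) - 1))"
    and "emeasure lborel (tube k R \<inter> cball x\<^sub>0 r) \<le> ennreal (R * sqrt R ^ (CARD('n) - 1))"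
proof -
  have n: "real CARD('n) \<ge> 1" using zero_less_card_finite[where 'a='n] by linarith
  have shrink: "y / (6 * real CARD('n)) \<le> y" if "y \<ge> 0" for y
    using mult_left_mono[of 1 "6 * real CARD('n)" y] n that by (simp add: divide_le_eq)
  have comp: "x\<^sub>0 $ j - r \<le> x $ j \<and> x $ j \<le> x\<^sub>0 $ j + r" if "x \<in> cball x\<^sub>0 r" for x j
    using that component_le_norm_cart[of "x - x\<^sub>0" j] by (auto simp: dist_norm norm_minus_commute)
  have "tube k R \<inter> cball x\<^sub>0 r \<subseteq> cbox (\<chi> j. x\<^sub>0 $ j - r) (\<chi> j. x\<^sub>0 $ j + r)"
    using comp by (auto simp: mem_box_cart)
  then have "emeasure lborel (tube k R \<inter> cball x\<^sub>0 r)
      \<le> emeasure lborel (cbox (\<chi> j. x\<^sub>0 $ j - r) (\<chi> j. x\<^sub>0 $ j + r))"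
    by (rule emeasure_mono) simp
  also have "\<dots> = ennreal (2 * r * (2 * r) ^ (CARD('n) - 1))"
    using assms by (intro emeasure_cbox_axis[where k=k]) auto
  finally show "emeasure lborel (tube k R \<inter> cball x\<^sub>0 r) \<le> ennreal (2 * r * (2 * r) ^ (CARD('n) - 1))" .
  let ?t = "tube_corner k R"
  have "tube k R \<inter> cball x\<^sub>0 r
      \<subseteq> cbox (\<chi> j. if j = k then x\<^sub>0 $ j - r else - ?t $ j) (\<chi> j. if j = k then x\<^sub>0 $ j + r else ?t $ j)"
    using comp by (auto simp: mem_box_cart tube_def)
  then have "emeasure lborel (tube k R \<inter> cball x\<^sub>0 r)
      \<le> emeasure lborel (cbox (\<chi> j. if j = k then x\<^sub>0 $ j - r else - ?t $ j)
            (\<chi> j. if j = k then x\<^sub>0 $ j + r else ?t $ j))"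
    by (rule emeasure_mono) simp
  also have "\<dots> = ennreal (2 * r * (sqrt R / (6 * real CARD('n))) ^ (CARD('n) - 1))"
    using assms by (intro emeasure_cbox_axis[where k=k]) (auto simp: tube_corner_def)
  also have "\<dots> \<le> ennreal (2 * r * sqrt R ^ (CARD('n) - 1))"
    using assms shrink[of "sqrt R"] by (intro ennreal_leI mult_left_mono power_mono) auto
  finally show "emeasure lborel (tube k R \<inter> cball x\<^sub>0 r) \<le> ennreal (2 * r * sqrt R ^ (CARD('n) - 1))" .
  have "emeasure lborel (tube k R \<inter> cball x\<^sub>0 r) \<le> emeasure lborel (tube k R)"
    by (rule emeasure_mono) (auto simp: tube_def)
  also have "\<dots> = ennreal (R / (6 * real CARD('n)) * (sqrt R / (6 * real CARD('n))) ^ (CARD('n) - 1))"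
    using assms by (simp add: emeasure_tube)
  also have "\<dots> \<le> ennreal (R * sqrt R ^ (CARD('n) - 1))"
    using assms shrink[of "sqrt R"] shrink[of R]
    by (intro ennreal_leI mult_mono power_mono) auto
  finally show "emeasure lborel (tube k R \<inter> cball x\<^sub>0 r) \<le> ennreal (R * sqrt R ^ (CARD('n) - 1))" .
qed

section \<open>Testing the estimate on Knapp examples\<close>

text \<open>One \<open>\<epsilon>\<close> and one constant \<open>C\<close> are fixed, so each
  example yields an exponent inequality still containing \<open>\<epsilon>\<close>. The direction
  \<open>k\<close> is the axis of the cap, of the tube and of the row of points.\<close>

locale weighted_restriction =
  fixes \<alpha> q \<epsilon> C :: real and k :: "'n::finite"
  assumes \<alpha>_pos: "0 < \<alpha>" and q_pos: "0 < q" and C_nonneg: "0 \<le> C"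
    and estimate: "\<And>f (H :: real ^ 'n \<Rightarrow> real) R. f \<in> L2_sphere \<Longrightarrow> R \<ge> 1 \<Longrightarrow> weight_of_dim \<alpha> H \<Longrightarrow>
      (\<integral>\<^sup>+x\<in>cball 0 R. ennreal (norm (extension_op f x) powr q * H x) \<partial>lebesgue)
        \<le> ennreal (C * R powr \<epsilon>) * A_dim \<alpha> H * ennreal (norm_L2_sphere f powr q)"
begin

text \<open>The form in which both examples use the estimate: the right-hand side is monotone in
  \<open>A_dim\<close>, so this may be replaced by any admissible \<open>D\<close>.\<close>

lemma estimate_const_weight:
  fixes T :: "(real ^ 'n) set"
  assumes f: "f \<in> L2_sphere" and R: "R \<ge> 1" and T [measurable]: "T \<in> sets borel" "T \<subseteq> cball 0 R"
    and c: "0 \<le> c" "c \<le> 1" and D: "0 \<le> D"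
    and dim: "\<And>x\<^sub>0 r. r \<ge> 1 \<Longrightarrow> ennreal c * emeasure lborel (T \<inter> cball x\<^sub>0 r) \<le> ennreal D * ennreal (r powr \<alpha>)"
  shows "ennreal c * (\<integral>\<^sup>+x\<in>T. ennreal (norm (extension_op f x) powr q) \<partial>lborel)
    \<le> ennreal (C * R powr \<epsilon> * D * norm_L2_sphere f powr q)"
proof -
  have [measurable]: "extension_op f \<in> borel_measurable borel"
    using f by (intro borel_measurable_extension_op) (simp add: L2_sphere_def)
  have "ennreal c * (\<integral>\<^sup>+x\<in>T. ennreal (norm (extension_op f x) powr q) \<partial>lborel)
      = (\<integral>\<^sup>+x. ennreal c * (ennreal (norm (extension_op f x) powr q) * indicator T x) \<partial>lborel)"
    by (rule nn_integral_cmult[symmetric]) measurable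
  also have "\<dots> = (\<integral>\<^sup>+x\<in>cball 0 R. ennreal (norm (extension_op f x) powr q * (c * indicator T x)) \<partial>lebesgue)"
    unfolding nn_integral_completion using T c
    by (intro nn_integral_cong) (auto simp: indicator_def mult.commute simp flip: ennreal_mult')
  also have "\<dots> \<le> ennreal (C * R powr \<epsilon>) * A_dim \<alpha> (\<lambda>x. c * indicator T x) * ennreal (norm_L2_sphere f powr q)"
    using f R T c dim by (intro estimate weight_const_on(2)[where D = D])
  also have "\<dots> \<le> ennreal (C * R powr \<epsilon>) * ennreal D * ennreal (norm_L2_sphere f powr q)"
    using T c dim by (intro mult_right_mono mult_left_mono weight_const_on(1)) auto
  also have "\<dots> = ennreal (C * R powr \<epsilon> * D * norm_L2_sphere f powr q)"
    using C_nonneg D by (simp add: ennreal_mult)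
  finally show ?thesis .
qed

text \<open>The test function is the indicator of a cap of measure \<open>s\<close>. The left side
  is at least \<open>c * (s / 2) powr q\<close> times the volume of the tube, while the norm on the
  right gives \<open>s powr (q / 2)\<close>. After cancellation a positive power of \<open>s\<close>
  remains on the left, so a lower bound for \<open>s\<close> suffices. \<open>K\<close> is chosen
  before \<open>R\<close>, \<open>c\<close> and \<open>D\<close>, which lets \<open>R\<close> tend
  to infinity.\<close>

lemma knapp_estimate:
  obtains K where "\<And>R c D. \<lbrakk>R \<ge> 1; 0 \<le> c; c \<le> 1; 0 \<le> D;
      \<And>x\<^sub>0 r. r \<ge> 1 \<Longrightarrow> ennreal c * emeasure lborel (tube k R \<inter> cball x\<^sub>0 r) \<le> ennreal D * ennreal (r powr \<alpha>)\<rbrakk> \<Longrightarrow>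
      c * R powr ((real CARD('n) + 1) / 2) \<le> K * D * R powr (\<epsilon> + q * (real CARD('n) - 1) / 4)"
proof -
  let ?n = "real CARD('n)"
  define c\<^sub>0 where "c\<^sub>0 = ?n / 4 * (1 / (2 * ?n)) ^ (CARD('n) - 1)"
  \<comment> \<open>The factors come from the volume of the tube, the measure of the cap, and the
    factor 1/2 lost in \<open>norm_extension_op_indicator_ge\<close>.\<close>
  define \<kappa> where "\<kappa> = (1 / (6 * ?n)) ^ CARD('n) * c\<^sub>0 powr (q / 2) * 2 powr (- q)"
  have n: "?n \<ge> 1" using zero_less_card_finite[where 'a='n] by linarith
  have "c\<^sub>0 > 0" using n by (simp add: c\<^sub>0_def)
  then have "\<kappa> > 0" using n by (simp add: \<kappa>_def)
  have n1: "real (CARD('n) - 1) = ?n - 1" using n by (simp add: of_nat_diff)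
  have main: "c * R powr ((?n + 1) / 2) \<le> C / \<kappa> * D * R powr (\<epsilon> + q * (?n - 1) / 4)"
    if R: "R \<ge> 1" and c: "0 \<le> c" "c \<le> 1" and D: "0 \<le> D"
      and dim: "\<And>x\<^sub>0 r. r \<ge> 1 \<Longrightarrow>
        ennreal c * emeasure lborel (tube k R \<inter> cball x\<^sub>0 r) \<le> ennreal D * ennreal (r powr \<alpha>)"
    for R c D :: real
  proof -
    define \<rho> where "\<rho> = 1 / sqrt R"
    have \<rho>: "0 < \<rho>" "\<rho> \<le> 1" "\<rho>\<^sup>2 = 1 / R" "\<rho> * sqrt R = 1" using R by (auto simp: \<rho>_def power_divide)
    define s where "s = measure sphere_measure (cap k \<rho>)"
    define f where "f = (indicator (cap k \<rho>) :: real ^ 'n \<Rightarrow> complex)"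
    define V where "V = R / (6 * ?n) * (sqrt R / (6 * ?n)) ^ (CARD('n) - 1)"
    have V0: "V \<ge> 0" using R by (simp add: V_def)
    have V: "V = (1 / (6 * ?n)) ^ CARD('n) * R powr ((?n + 1) / 2)"
    proof -
      have "R * R powr ((?n - 1) / 2) = R powr (1 + (?n - 1) / 2)"
        using R by (simp add: powr_add)
      also have "1 + (?n - 1) / 2 = (?n + 1) / 2" by (simp add: field_simps)
      finally have "R * sqrt R ^ (CARD('n) - 1) = R powr ((?n + 1) / 2)"
        using R n1 by (simp add: sqrt_power_eq_powr)
      moreover have "(6 * ?n) * (6 * ?n) ^ (CARD('n) - 1) = (6 * ?n) ^ CARD('n)"
        using power_minus_mult[of "CARD('n)" "6 * ?n"] by (simp add: mult.commute)
      ultimately show ?thesis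
        by (simp add: V_def power_divide flip: times_divide_times_eq)
    qed
    have s: "s \<ge> c\<^sub>0 * R powr (- ((?n - 1) / 2))"
    proof -
      have "c\<^sub>0 * R powr (- ((?n - 1) / 2)) = ?n / 4 * (\<rho> / (2 * ?n)) ^ (CARD('n) - 1)"
        using R n1 by (simp add: c\<^sub>0_def \<rho>_def power_divide power_mult_distrib sqrt_power_eq_powr powr_minus divide_simps)
      then show ?thesis using measure_cap_ge[OF \<rho>(1,2), of k] by (simp add: s_def)
    qed
    have "s > 0" using \<open>c\<^sub>0 > 0\<close> R by (intro less_le_trans[OF _ s]) simp
    have ge: "(s / 2) powr q \<le> norm (extension_op f x) powr q" if x: "x \<in> tube k R" for x
    proof -
      have "s / 2 \<le> norm (extension_op f x)"
        unfolding s_def f_def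
      proof (rule norm_extension_op_indicator_ge[where e = "axis k 1"])
        fix \<xi> assume \<xi>: "\<xi> \<in> cap k \<rho>"
        show "\<bar>x \<bullet> (\<xi> - axis k 1)\<bar> \<le> 1 / 6"
        proof (rule cap_phase[OF \<xi> \<rho>(1)])
          show "\<bar>x $ k\<bar> * \<rho>\<^sup>2 \<le> 1 / (12 * ?n)"
            using mult_right_mono[OF tube_component(1)[OF x], of "\<rho>\<^sup>2"] \<rho>(3) R by simp
          show "\<bar>x $ j\<bar> * \<rho> \<le> 1 / (12 * ?n)" if "j \<noteq> k" for j
            using mult_right_mono[OF tube_component(2)[OF x that], of \<rho>] \<rho>(1,4) by (simp add: mult.commute)
        qed
      qed (use cap_subset_sphere in simp_all)
      then show ?thesis using q_pos \<open>s > 0\<close> by (intro powr_mono2) auto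
    qed
    have "ennreal (c * ((s / 2) powr q * V)) = ennreal c * (ennreal ((s / 2) powr q) * emeasure lborel (tube k R))"
      using c V0 R emeasure_tube[of R k] unfolding V_def[symmetric] by (simp add: ennreal_mult)
    also have "\<dots> = ennreal c * (\<integral>\<^sup>+x. ennreal ((s / 2) powr q) * indicator (tube k R) x \<partial>lborel)"
      by (simp add: nn_integral_cmult_indicator)
    also have "\<dots> \<le> ennreal c * (\<integral>\<^sup>+x\<in>tube k R. ennreal (norm (extension_op f x) powr q) \<partial>lborel)"
      using ge by (intro mult_left_mono nn_integral_mono) (auto simp: indicator_def ennreal_leI)
    also have "\<dots> \<le> ennreal (C * R powr \<epsilon> * D * norm_L2_sphere f powr q)"
    proof (rule estimate_const_weight[OF _ R borel_tube tube_subset_cball[OF R] c D dim])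
      show "f \<in> L2_sphere"
        unfolding f_def by (rule bounded_in_L2_sphere[of _ 1]) (auto simp: indicator_def)
    qed
    also have "norm_L2_sphere f powr q = s powr (q / 2)"
      unfolding f_def s_def norm_L2_sphere_indicator[OF borel_cap cap_subset_sphere]
      by (simp add: powr_half_sqrt[symmetric] powr_powr)
    finally have "c * ((s / 2) powr q * V) \<le> C * R powr \<epsilon> * D * s powr (q / 2)"
      using C_nonneg D by (subst (asm) ennreal_le_iff) auto
    \<comment> \<open>Half of the power of \<open>s\<close> is split off to cancel the norm of
      \<open>f\<close>.\<close>
    also have "c * ((s / 2) powr q * V) = c * (s powr (q / 2) * 2 powr (- q) * V) * s powr (q / 2)"
      using \<open>s > 0\<close> by (simp add: powr_divide powr_minus divide_simps flip: powr_add)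
    finally have "c * (s powr (q / 2) * 2 powr (- q) * V) \<le> C * R powr \<epsilon> * D"
      by (rule mult_right_le_imp_le) (use \<open>s > 0\<close> in simp)
    moreover have "c * ((c\<^sub>0 powr (q / 2) * R powr (- (q * (?n - 1) / 4))) * 2 powr (- q) * V)
        \<le> c * (s powr (q / 2) * 2 powr (- q) * V)"
    proof -
      have "(c\<^sub>0 * R powr (- ((?n - 1) / 2))) powr (q / 2) \<le> s powr (q / 2)"
        using s q_pos \<open>c\<^sub>0 > 0\<close> by (intro powr_mono2) auto
      moreover have "(c\<^sub>0 * R powr (- ((?n - 1) / 2))) powr (q / 2) = c\<^sub>0 powr (q / 2) * R powr (- (q * (?n - 1) / 4))"
        using \<open>c\<^sub>0 > 0\<close> by (simp add: powr_mult powr_powr mult.commute)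
      ultimately show ?thesis using c V0 by (intro mult_left_mono mult_right_mono) auto
    qed
    ultimately have "\<kappa> * (c * R powr ((?n + 1) / 2)) * R powr (- (q * (?n - 1) / 4)) \<le> C * R powr \<epsilon> * D"
      unfolding V \<kappa>_def by (simp add: mult_ac)
    then have "\<kappa> * (c * R powr ((?n + 1) / 2)) * R powr (- (q * (?n - 1) / 4)) * R powr (q * (?n - 1) / 4)
        \<le> C * R powr \<epsilon> * D * R powr (q * (?n - 1) / 4)"
      by (intro mult_right_mono) auto
    then have "\<kappa> * (c * R powr ((?n + 1) / 2)) \<le> C * D * R powr (\<epsilon> + q * (?n - 1) / 4)"
      using R by (simp add: powr_minus powr_add mult_ac)
    then show ?thesis
      using \<open>\<kappa> > 0\<close> by (simp add: field_simps)
  qed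
  show thesis by (rule that) (rule main)
qed

text \<open>The constant \<open>c\<close> is tuned to the radius \<open>sqrt R\<close>, where
  \<open>c\<close> times the volume of a ball is comparable to \<open>r powr \<alpha>\<close>. The
  weight then has a dimension constant independent of \<open>R\<close>, and its total mass is of
  order \<open>R powr ((\<alpha> + 1) / 2)\<close>.\<close>

lemma knapp_exponent_large:
  assumes \<alpha>: "1 \<le> \<alpha>" "\<alpha> \<le> real CARD('n)"
  shows "(\<alpha> + 1) / 2 \<le> \<epsilon> + q * (real CARD('n) - 1) / 4"
proof -
  let ?n = "real CARD('n)"
  have n: "?n \<ge> 1" using zero_less_card_finite[where 'a='n] by linarith
  have n1: "real (CARD('n) - 1) = ?n - 1" using n by (simp add: of_nat_diff)
  obtain K where K: "\<And>R c D. \<lbrakk>R \<ge> 1; 0 \<le> c; c \<le> 1; 0 \<le> D;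
      \<And>x\<^sub>0 r. r \<ge> 1 \<Longrightarrow> ennreal c * emeasure lborel (tube k R \<inter> cball x\<^sub>0 r) \<le> ennreal D * ennreal (r powr \<alpha>)\<rbrakk> \<Longrightarrow>
      c * R powr ((?n + 1) / 2) \<le> K * D * R powr (\<epsilon> + q * (?n - 1) / 4)"
    using knapp_estimate by blast
  show ?thesis
  proof (rule powr_le_powr_imp_le)
    fix N :: nat assume "N \<ge> 1"
    define R where "R = real N"
    have R: "R \<ge> 1" using \<open>N \<ge> 1\<close> by (simp add: R_def)
    define c where "c = R powr (- ((?n - \<alpha>) / 2))"
    have c: "0 \<le> c" "c \<le> 1"
      using R \<alpha> powr_mono[of "- ((?n - \<alpha>) / 2)" 0 R] by (simp_all add: c_def)
    have "ennreal c * emeasure lborel (tube k R \<inter> cball x\<^sub>0 r) \<le> ennreal (2 ^ CARD('n)) * ennreal (r powr \<alpha>)"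
      if r: "r \<ge> 1" for x\<^sub>0 r
    proof (cases "r \<le> sqrt R")
      \<comment> \<open>Here the ball may fit inside the tube in all directions;
        \<open>\<alpha> \<le> n\<close> makes the largest radius \<open>sqrt R\<close> the
        worst.\<close>
      case True
      have "r powr (?n - \<alpha>) \<le> sqrt R powr (?n - \<alpha>)"
        using True r \<alpha> by (intro powr_mono2) auto
      also have "\<dots> = R powr ((?n - \<alpha>) / 2)"
        using R by (simp add: powr_half_sqrt[symmetric] powr_powr)
      finally have "c * r powr (?n - \<alpha>) \<le> c * R powr ((?n - \<alpha>) / 2)"
        using c by (intro mult_left_mono)
      also have "\<dots> = 1" using R by (simp add: c_def flip: powr_add)
      finally have "c * r powr (?n - \<alpha>) \<le> 1" .
      then have "(c * r powr (?n - \<alpha>)) * (2 ^ CARD('n) * r powr \<alpha>) \<le> 1 * (2 ^ CARD('n) * r powr \<alpha>)"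
        by (intro mult_right_mono) auto
      moreover have "(c * r powr (?n - \<alpha>)) * (2 ^ CARD('n) * r powr \<alpha>) = c * (2 * r * (2 * r) ^ (CARD('n) - 1))"
      proof -
        have "r powr (?n - \<alpha>) * r powr \<alpha> = r ^ CARD('n)"
          using r by (simp add: powr_realpow flip: powr_add)
        moreover have "2 * r * (2 * r) ^ (CARD('n) - 1) = 2 ^ CARD('n) * r ^ CARD('n)"
          using power_minus_mult[of "CARD('n)" "2 * r"] by (simp add: power_mult_distrib mult.commute)
        ultimately show ?thesis by (metis mult.assoc mult.commute)
      qed
      ultimately have "ennreal (c * (2 * r * (2 * r) ^ (CARD('n) - 1))) \<le> ennreal (2 ^ CARD('n) * r powr \<alpha>)"
        by (intro ennreal_leI) simp
      moreover have "ennreal c * emeasure lborel (tube k R \<inter> cball x\<^sub>0 r) \<le> ennreal (c * (2 * r * (2 * r) ^ (CARD('n) - 1)))"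
        unfolding ennreal_mult'[OF c(1)] by (intro mult_left_mono emeasure_tube_Int_cball R r) simp
      ultimately show ?thesis by (subst ennreal_mult'[symmetric]) (simp, rule order_trans[rotated])
    next
      \<comment> \<open>Now the mass grows linearly in \<open>r\<close>; since
        \<open>\<alpha> \<ge> 1\<close>, the smallest radius \<open>sqrt R\<close> is the
        worst.\<close>
      case False
      have "sqrt R ^ (CARD('n) - 1) = R powr ((?n - 1) / 2)"
        using R n1 by (simp add: sqrt_power_eq_powr)
      then have "c * sqrt R ^ (CARD('n) - 1) = R powr ((\<alpha> - 1) / 2)"
        by (simp add: c_def diff_divide_distrib flip: powr_add)
      also have "\<dots> = sqrt R powr (\<alpha> - 1)"
        using R by (simp add: powr_half_sqrt[symmetric] powr_powr)
      also have "\<dots> \<le> r powr (\<alpha> - 1)"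
        using False \<alpha> R by (intro powr_mono2) auto
      finally have "2 * r * (c * sqrt R ^ (CARD('n) - 1)) \<le> 2 * r * r powr (\<alpha> - 1)"
        using r by (intro mult_left_mono) auto
      also have "\<dots> = 2 * r powr \<alpha>" using r by (simp add: powr_diff)
      also have "\<dots> \<le> 2 ^ CARD('n) * r powr \<alpha>"
        using n power_increasing[of 1 "CARD('n)" "2 :: real"] by (intro mult_right_mono) auto
      finally have "ennreal (c * (2 * r * sqrt R ^ (CARD('n) - 1))) \<le> ennreal (2 ^ CARD('n) * r powr \<alpha>)"
        by (intro ennreal_leI) (simp add: mult_ac)
      moreover have "ennreal c * emeasure lborel (tube k R \<inter> cball x\<^sub>0 r) \<le> ennreal (c * (2 * r * sqrt R ^ (CARD('n) - 1)))"
        unfolding ennreal_mult'[OF c(1)] by (intro mult_left_mono emeasure_tube_Int_cball R r) simp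
      ultimately show ?thesis by (subst ennreal_mult'[symmetric]) (simp, rule order_trans[rotated])
    qed
    from K[OF R c _ this] have "c * R powr ((?n + 1) / 2) \<le> K * 2 ^ CARD('n) * R powr (\<epsilon> + q * (?n - 1) / 4)"
      by simp
    moreover have "c * R powr ((?n + 1) / 2) = R powr ((\<alpha> + 1) / 2)"
      unfolding c_def by (simp add: diff_divide_distrib add_divide_distrib flip: powr_add)
    ultimately show "real N powr ((\<alpha> + 1) / 2) \<le> K * 2 ^ CARD('n) * real N powr (\<epsilon> + q * (?n - 1) / 4)"
      by (simp add: R_def)
  qed
qed

text \<open>For \<open>\<alpha> \<le> 1\<close> linear growth of the mass is at least as fast as
  \<open>r powr \<alpha>\<close>, so the critical radius moves to the full length \<open>R\<close>,
  and \<open>c\<close> is chosen to give the tube mass of order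
  \<open>R powr \<alpha>\<close>.\<close>

lemma knapp_exponent_small:
  assumes \<alpha>: "\<alpha> \<le> 1"
  shows "\<alpha> \<le> \<epsilon> + q * (real CARD('n) - 1) / 4"
proof -
  let ?n = "real CARD('n)"
  have n: "?n \<ge> 1" using zero_less_card_finite[where 'a='n] by linarith
  have n1: "real (CARD('n) - 1) = ?n - 1" using n by (simp add: of_nat_diff)
  obtain K where K: "\<And>R c D. \<lbrakk>R \<ge> 1; 0 \<le> c; c \<le> 1; 0 \<le> D;
      \<And>x\<^sub>0 r. r \<ge> 1 \<Longrightarrow> ennreal c * emeasure lborel (tube k R \<inter> cball x\<^sub>0 r) \<le> ennreal D * ennreal (r powr \<alpha>)\<rbrakk> \<Longrightarrow>
      c * R powr ((?n + 1) / 2) \<le> K * D * R powr (\<epsilon> + q * (?n - 1) / 4)"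
    using knapp_estimate by blast
  show ?thesis
  proof (rule powr_le_powr_imp_le)
    fix N :: nat assume "N \<ge> 1"
    define R where "R = real N"
    have R: "R \<ge> 1" using \<open>N \<ge> 1\<close> by (simp add: R_def)
    define c where "c = R powr (\<alpha> - (?n + 1) / 2)"
    have c: "0 \<le> c" "c \<le> 1"
    proof -
      have "1 \<le> (?n + 1) / 2" using n by simp
      then have "\<alpha> - (?n + 1) / 2 \<le> 0" using \<alpha> by linarith
      then show "0 \<le> c" "c \<le> 1"
        using R powr_mono[of "\<alpha> - (?n + 1) / 2" 0 R] by (simp_all add: c_def)
    qed
    have c': "c * sqrt R ^ (CARD('n) - 1) = R powr (\<alpha> - 1)"
    proof -
      have "c * sqrt R ^ (CARD('n) - 1) = R powr (\<alpha> - (?n + 1) / 2 + (?n - 1) / 2)"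
        using R n1 by (simp add: c_def sqrt_power_eq_powr powr_add)
      also have "\<alpha> - (?n + 1) / 2 + (?n - 1) / 2 = \<alpha> - 1" by (simp add: field_simps)
      finally show ?thesis .
    qed
    have "ennreal c * emeasure lborel (tube k R \<inter> cball x\<^sub>0 r) \<le> ennreal 2 * ennreal (r powr \<alpha>)"
      if r: "r \<ge> 1" for x\<^sub>0 r
    proof (cases "r \<le> R")
      case True
      have "2 * r * R powr (\<alpha> - 1) \<le> 2 * r * r powr (\<alpha> - 1)"
        using True r \<alpha> by (intro mult_left_mono powr_mono2') auto
      also have "\<dots> = 2 * r powr \<alpha>" using r by (simp add: powr_diff)
      finally have "ennreal (c * (2 * r * sqrt R ^ (CARD('n) - 1))) \<le> ennreal (2 * r powr \<alpha>)"
        by (intro ennreal_leI) (simp add: mult_ac flip: c')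
      moreover have "ennreal c * emeasure lborel (tube k R \<inter> cball x\<^sub>0 r) \<le> ennreal (c * (2 * r * sqrt R ^ (CARD('n) - 1)))"
        unfolding ennreal_mult'[OF c(1)] by (intro mult_left_mono emeasure_tube_Int_cball R r) simp
      ultimately show ?thesis by (subst ennreal_mult'[symmetric]) (simp, rule order_trans[rotated])
    next
      case False
      have "R * R powr (\<alpha> - 1) = R powr \<alpha>" using R by (simp add: powr_diff)
      also have "\<dots> \<le> r powr \<alpha>" using False R \<alpha>_pos by (intro powr_mono2) auto
      also have "\<dots> \<le> 2 * r powr \<alpha>" by simp
      finally have "ennreal (c * (R * sqrt R ^ (CARD('n) - 1))) \<le> ennreal (2 * r powr \<alpha>)"
        by (intro ennreal_leI) (simp add: mult_ac flip: c')
      moreover have "ennreal c * emeasure lborel (tube k R \<inter> cball x\<^sub>0 r) \<le> ennreal (c * (R * sqrt R ^ (CARD('n) - 1)))"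
        unfolding ennreal_mult'[OF c(1)] by (intro mult_left_mono emeasure_tube_Int_cball R r) simp
      ultimately show ?thesis by (subst ennreal_mult'[symmetric]) (simp, rule order_trans[rotated])
    qed
    from K[OF R c _ this] have "c * R powr ((?n + 1) / 2) \<le> K * 2 * R powr (\<epsilon> + q * (?n - 1) / 4)"
      by simp
    moreover have "c * R powr ((?n + 1) / 2) = R powr \<alpha>"
      unfolding c_def by (simp flip: powr_add)
    ultimately show "real N powr \<alpha> \<le> K * 2 * real N powr (\<epsilon> + q * (?n - 1) / 4)"
      by (simp add: R_def)
  qed
qed

section \<open>Random signs on sparse balls\<close>

text \<open>The points \<open>j L e\<^sub>k\<close>, \<open>j < N\<close>, with \<open>L = 4 N\<^bsup>1/\<alpha>\<^esup>\<close> are so sparse that a ball of radius \<open>r\<close>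
  meets at most one of the balls around them unless \<open>r\<^bsup>\<alpha>\<^esup> \<ge> N\<close>.\<close>

lemma sparse_exponent:
  assumes "q < 2"
  shows "1 \<le> (1 + 1 / \<alpha>) * \<epsilon> + q / 2"
proof -
  define s where "s = measure (sphere_measure :: (real ^ 'n) measure) (sphere 0 1)"
  have "s \<ge> measure sphere_measure (cap k 1)"
    unfolding s_def using cap_subset_sphere[of k 1] by (intro sphere.finite_measure_mono) (auto simp: sets_restrict_space_iff)
  moreover have "0 < real CARD('n) / 4 * (1 / (2 * real CARD('n))) ^ (CARD('n) - 1)"
    by simp
  ultimately have s: "s > 0"
    using measure_cap_ge[of 1 k] by linarith
  define v where "v = measure lborel (cball (0 :: real ^ 'n) (1 / 6))"
  have v: "emeasure lborel (cball (x :: real ^ 'n) (1 / 6)) = ennreal v" for x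
    using emeasure_cball[of "1 / 6" x] emeasure_cball[of "1 / 6" "0 :: real ^ 'n"] by (simp add: v_def measure_def)
  have v_pos: "v > 0"
    using content_cball_pos[of "1 / 6" "0 :: real ^ 'n"] by (simp add: v_def)
  \<comment> \<open>By Cauchy-Schwarz all phases are below the threshold when \<open>norm y\<close>
    is at most 1/6; this fixes the radius of the balls.\<close>
  define g where "g = extension_op (indicator (sphere 0 1) :: real ^ 'n \<Rightarrow> complex)"
  have g: "s / 2 \<le> norm (g y)" if "norm y \<le> 1 / 6" for y
    unfolding s_def g_def
  proof (rule norm_extension_op_indicator_ge[where e = 0])
    fix \<xi> :: "real ^ 'n" assume "\<xi> \<in> sphere 0 1"
    then show "\<bar>y \<bullet> (\<xi> - 0)\<bar> \<le> 1 / 6"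
      using Cauchy_Schwarz_ineq2[of y \<xi>] that by simp
  qed auto
  \<comment> \<open>\<open>4 powr \<epsilon>\<close> comes from \<open>R\<close>,
    \<open>1 + s\<close> from the two terms of \<open>powr_le_split\<close>, and the remaining
    factors from the lower bound \<open>B\<close>.\<close>
  define K where "K = C * 4 powr \<epsilon> * (1 + s) * 2 / (s / 2) powr q"
  show ?thesis
  proof (rule powr_le_powr_imp_le)
    fix N :: nat assume N: "N \<ge> 1"
    \<comment> \<open>Two balls meeting \<open>cball x\<^sub>0 r\<close> have centres at distance at
      most \<open>2 * r + 1 / 3\<close>, which is less than \<open>L\<close> if
      \<open>1 \<le> r < N powr (1 / \<alpha>)\<close>. Since \<open>R\<close> is only a power of
      \<open>N\<close>, the loss \<open>R powr \<epsilon>\<close> stays harmless.\<close>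
    define L where "L = 4 * real N powr (1 / \<alpha>)"
    define R where "R = real N * L"
    have L: "L \<ge> 4" using N \<alpha>_pos ge_one_powr_ge_zero[of N "1 / \<alpha>"] by (simp add: L_def)
    have R: "R \<ge> 1" using L N mult_mono[of 1 "real N" 1 L] by (simp add: R_def)
    define p :: "nat \<Rightarrow> real ^ 'n" where "p j = (real j * L) *\<^sub>R axis k 1" for j
    have dist_p: "dist (p i) (p j) = \<bar>real i - real j\<bar> * L" for i j
    proof -
      have "p i - p j = ((real i - real j) * L) *\<^sub>R axis k 1"
        by (simp add: p_def algebra_simps)
      then show ?thesis using L by (simp add: dist_norm norm_axis_1 abs_mult)
    qed
    have dist_p_ge: "L \<le> dist (p i) (p j)" if "i \<noteq> j" for i j
    proof -
      have "1 \<le> \<bar>real i - real j\<bar>" using that by linarith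
      then show ?thesis using L mult_right_mono[of 1 "\<bar>real i - real j\<bar>" L] by (simp add: dist_p)
    qed
    define T where "T = (\<Union>j<N. cball (p j) (1 / 6))"
    have T [measurable]: "T \<in> sets borel" by (auto simp: T_def)
    have T_sub: "T \<subseteq> cball 0 R"
    proof
      fix x assume "x \<in> T"
      then obtain j where j: "j < N" "dist (p j) x \<le> 1 / 6" by (auto simp: T_def)
      have "norm (p j) = real j * L" using L by (simp add: p_def norm_axis_1)
      moreover have "(real j + 1) * L \<le> R" unfolding R_def using j L by (intro mult_right_mono) auto
      moreover have "norm x \<le> norm (p j) + dist (p j) x"
        using norm_triangle_ineq4[of "p j" "p j - x"] by (simp add: dist_norm)
      ultimately show "x \<in> cball 0 R" using j L by (simp add: algebra_simps)
    qed
    have disj: "disjoint_family_on (\<lambda>j. cball (p j) (1 / 6)) {..<N}"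
      unfolding disjoint_family_on_def
    proof (intro ballI impI)
      fix i j assume "i \<in> {..<N}" "j \<in> {..<N}" "i \<noteq> j"
      with dist_p_ge have "L \<le> dist (p i) (p j)" by blast
      moreover have "dist (p i) (p j) < L" if "x \<in> cball (p i) (1 / 6)" "x \<in> cball (p j) (1 / 6)" for x
        using that L dist_triangle2[of "p i" "p j" x] by simp
      ultimately show "cball (p i) (1 / 6) \<inter> cball (p j) (1 / 6) = {}"
        by fastforce
    qed
    have T_meas: "emeasure lborel T = ennreal (real N * v)"
    proof -
      have "emeasure lborel T = (\<Sum>j<N. emeasure lborel (cball (p j) (1 / 6)))"
        unfolding T_def by (rule sum_emeasure[symmetric]) (use disj in auto)
      then show ?thesis using v_pos by (simp add: v ennreal_mult ennreal_of_nat_eq_real_of_nat)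
    qed
    have dim: "ennreal 1 * emeasure lborel (T \<inter> cball x\<^sub>0 r) \<le> ennreal v * ennreal (r powr \<alpha>)" if r: "r \<ge> 1" for x\<^sub>0 r
    proof (cases "r < real N powr (1 / \<alpha>)")
      case True
      have "\<exists>x. T \<inter> cball x\<^sub>0 r \<subseteq> cball x (1 / 6)"
      proof (cases "T \<inter> cball x\<^sub>0 r = {}")
        case False
        then obtain y i where y: "y \<in> cball x\<^sub>0 r" "y \<in> cball (p i) (1 / 6)"
          by (auto simp: T_def)
        have "T \<inter> cball x\<^sub>0 r \<subseteq> cball (p i) (1 / 6)"
        proof
          fix z assume "z \<in> T \<inter> cball x\<^sub>0 r"
          then obtain j where z: "z \<in> cball x\<^sub>0 r" "z \<in> cball (p j) (1 / 6)"
            by (auto simp: T_def)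
          have "dist (p i) (p j) \<le> dist (p i) y + dist y x\<^sub>0 + dist x\<^sub>0 z + dist z (p j)"
            using dist_triangle[of "p i" "p j" y] dist_triangle[of y "p j" x\<^sub>0] dist_triangle[of x\<^sub>0 "p j" z] by linarith
          also have "\<dots> < L"
            using y z True r by (simp add: L_def dist_commute)
          finally have "i = j" using dist_p_ge[of i j] by fastforce
          with z show "z \<in> cball (p i) (1 / 6)" by simp
        qed
        then show ?thesis by blast
      qed auto
      then obtain x where "T \<inter> cball x\<^sub>0 r \<subseteq> cball x (1 / 6)" by blast
      then have "emeasure lborel (T \<inter> cball x\<^sub>0 r) \<le> ennreal v"
        unfolding v[of x, symmetric] by (rule emeasure_mono) simp
      also have "\<dots> \<le> ennreal (v * r powr \<alpha>)"
        using v_pos r \<alpha>_pos ge_one_powr_ge_zero[of r \<alpha>] by (intro ennreal_leI) simp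
      finally show ?thesis using v_pos by (simp add: ennreal_mult)
    next
      case False
      have "real N = (real N powr (1 / \<alpha>)) powr \<alpha>" using N \<alpha>_pos by (simp add: powr_powr)
      also have "\<dots> \<le> r powr \<alpha>" using False \<alpha>_pos by (intro powr_mono2) auto
      finally have "ennreal (real N * v) \<le> ennreal (v * r powr \<alpha>)"
        using v_pos by (intro ennreal_leI) simp
      moreover have "emeasure lborel (T \<inter> cball x\<^sub>0 r) \<le> emeasure lborel T"
        by (rule emeasure_mono) auto
      ultimately show ?thesis using v_pos by (simp add: ennreal_mult T_meas)
    qed
    \<comment> \<open>Multiplication by this character translates the extension by
      \<open>p j\<close>, so \<open>extension_op (f A)\<close> becomes a signed sum of translates of
      \<open>g\<close>.\<close>
    define w where "w j \<xi> = exp (2 * complex_of_real pi * \<i> * complex_of_real (p j \<bullet> \<xi>))" for j \<xi>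
    have norm_w: "norm (w j \<xi>) = 1" for j \<xi> by (simp add: w_def norm_exp_eq_Re)
    have [measurable]: "w j \<in> borel_measurable borel" for j unfolding w_def by measurable
    define f where "f A \<xi> = signed_sum {..<N} A (\<lambda>j. w j \<xi>)" for A \<xi>
    have f_meas [measurable]: "f A \<in> borel_measurable borel" for A
      unfolding f_def signed_sum_def by measurable
    have f_bound: "norm (f A \<xi>) \<le> real N" for A \<xi>
    proof -
      have "norm (f A \<xi>) \<le> (\<Sum>j<N. 1)"
        unfolding f_def signed_sum_def by (rule sum_norm_le) (simp add: norm_w)
      then show ?thesis by simp
    qed
    have f_L2: "f A \<in> L2_sphere" for A
      by (rule bounded_in_L2_sphere[OF f_meas f_bound])
    have Ef: "extension_op (f A) x = signed_sum {..<N} A (\<lambda>j. g (x - p j))" for A x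
    proof -
      \<comment> \<open>The indicator equals 1 on the space of the measure; it is kept so that the
        integral of \<open>h y\<close> is literally \<open>g y\<close>.\<close>
      define h where "h y \<xi> = exp (- 2 * complex_of_real pi * \<i> * complex_of_real (y \<bullet> \<xi>)) * indicator (sphere 0 1) \<xi>"
        for y \<xi> :: "real ^ 'n"
      have h: "integrable sphere_measure (h y)" for y
        unfolding h_def by (rule integrable_oscillating[of _ 1]) (auto simp: indicator_def)
      have signed: "integrable sphere_measure (\<lambda>\<xi>. if j \<in> A then h y \<xi> else - h y \<xi>)" for j y
        using h[of y] by (cases "j \<in> A") auto
      have "extension_op (f A) x = (\<integral>\<xi>. signed_sum {..<N} A (\<lambda>j. h (x - p j) \<xi>) \<partial>sphere_measure)"
        unfolding extension_op_def
      proof (rule Bochner_Integration.integral_cong)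
        fix \<xi> :: "real ^ 'n" assume "\<xi> \<in> space sphere_measure"
        then have "h (x - p j) \<xi> = exp (- 2 * complex_of_real pi * \<i> * complex_of_real (x \<bullet> \<xi>)) * w j \<xi>" for j
          by (simp add: h_def w_def inner_diff_left algebra_simps flip: exp_add)
        then show "exp (- 2 * complex_of_real pi * \<i> * complex_of_real (x \<bullet> \<xi>)) * f A \<xi>
            = signed_sum {..<N} A (\<lambda>j. h (x - p j) \<xi>)"
          unfolding f_def signed_sum_def sum_distrib_left by (intro sum.cong) auto
      qed simp
      also have "\<dots> = signed_sum {..<N} A (\<lambda>j. \<integral>\<xi>. h (x - p j) \<xi> \<partial>sphere_measure)"
        unfolding signed_sum_def using h signed
        by (subst Bochner_Integration.integral_sum) (auto intro!: sum.cong split: if_splits)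
      finally show ?thesis unfolding g_def extension_op_def h_def .
    qed
    have Ef_meas [measurable]: "extension_op (f A) \<in> borel_measurable borel" for A
      by (intro borel_measurable_extension_op borel_measurable_sphere) measurable
    define B where "B = 2 ^ N * ((s / 2) powr q / 2)"
    \<comment> \<open>The index \<open>i\<close> is that of a ball containing \<open>x\<close>. The
      other translates of \<open>g\<close> need not be small at \<open>x\<close>, as the bound holds
      for any values of them.\<close>
    have lower: "B \<le> (\<Sum>A\<in>Pow {..<N}. norm (extension_op (f A) x) powr q)" if x: "x \<in> T" for x
    proof -
      obtain i where i: "i < N" "dist (p i) x \<le> 1 / 6" using x by (auto simp: T_def)
      have "(s / 2) powr q \<le> norm (g (x - p i)) powr q"
        using g[of "x - p i"] i q_pos s by (intro powr_mono2) (auto simp: dist_norm norm_minus_commute)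
      then have "B \<le> 2 ^ card {..<N} * (norm (g (x - p i)) powr q / 2)"
        by (simp add: B_def)
      also have "\<dots> \<le> (\<Sum>A\<in>Pow {..<N}. norm (signed_sum {..<N} A (\<lambda>j. g (x - p j))) powr q)"
        using i q_pos by (intro sum_norm_signed_sum_powr_ge) auto
      finally show ?thesis by (simp add: Ef)
    qed
    \<comment> \<open>All characters have modulus 1, so the sum of squares over the signs is
      constant on the sphere.\<close>
    have norm_f: "(\<Sum>A\<in>Pow {..<N}. (norm_L2_sphere (f A))\<^sup>2) = 2 ^ N * real N * s"
    proof -
      have int: "integrable sphere_measure (\<lambda>\<xi>. (norm (f A \<xi>))\<^sup>2)" for A
        using f_L2[of A] by (simp add: L2_sphere_def)
      have "(\<Sum>A\<in>Pow {..<N}. (norm_L2_sphere (f A))\<^sup>2)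
          = (\<Sum>A\<in>Pow {..<N}. \<integral>\<xi>. (norm (f A \<xi>))\<^sup>2 \<partial>sphere_measure)"
        unfolding norm_L2_sphere_def by (intro sum.cong) (auto intro!: real_sqrt_pow2 integral_nonneg_AE)
      also have "\<dots> = (\<integral>\<xi>. (\<Sum>A\<in>Pow {..<N}. (norm (f A \<xi>))\<^sup>2) \<partial>sphere_measure)"
        using int by (intro Bochner_Integration.integral_sum[symmetric])
      also have "\<dots> = (\<integral>\<xi>. 2 ^ N * real N \<partial>(sphere_measure :: (real ^ 'n) measure))"
        by (simp add: f_def sum_norm_signed_sum_sq norm_w)
      also have "\<dots> = 2 ^ N * real N * s" by (simp add: s_def)
      finally show ?thesis .
    qed
    \<comment> \<open>The estimate is applied to every \<open>f A\<close> with the same weight,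
      \<open>c = 1\<close> and \<open>D = v\<close>, and the results are added; no single good
      choice of signs is extracted.\<close>
    have "ennreal (B * (real N * v)) = (\<integral>\<^sup>+x. ennreal B * indicator T x \<partial>lborel)"
      using v_pos s T by (simp add: nn_integral_cmult_indicator T_meas B_def flip: ennreal_mult')
    also have "\<dots> \<le> (\<integral>\<^sup>+x. (\<Sum>A\<in>Pow {..<N}. ennreal (norm (extension_op (f A) x) powr q) * indicator T x) \<partial>lborel)"
    proof (rule nn_integral_mono)
      fix x show "ennreal B * indicator T x
          \<le> (\<Sum>A\<in>Pow {..<N}. ennreal (norm (extension_op (f A) x) powr q) * indicator T x)"
        using lower[of x] by (cases "x \<in> T") (simp_all add: ennreal_leI sum_ennreal)
    qed
    also have "\<dots> = (\<Sum>A\<in>Pow {..<N}. ennreal 1 * (\<integral>\<^sup>+x\<in>T. ennreal (norm (extension_op (f A) x) powr q) \<partial>lborel))"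
      by (subst nn_integral_sum) auto
    also have "\<dots> \<le> (\<Sum>A\<in>Pow {..<N}. ennreal (C * R powr \<epsilon> * v * norm_L2_sphere (f A) powr q))"
      using f_L2 R T T_sub dim v_pos by (intro sum_mono estimate_const_weight) auto
    also have "\<dots> = ennreal (C * R powr \<epsilon> * v * (\<Sum>A\<in>Pow {..<N}. norm_L2_sphere (f A) powr q))"
      using C_nonneg v_pos by (simp add: sum_ennreal sum_distrib_left)
    finally have "B * (real N * v) \<le> C * R powr \<epsilon> * v * (\<Sum>A\<in>Pow {..<N}. norm_L2_sphere (f A) powr q)"
      using C_nonneg v_pos by (subst (asm) ennreal_le_iff) (auto intro!: sum_nonneg mult_nonneg_nonneg)
    then have BN: "B * real N \<le> C * R powr \<epsilon> * (\<Sum>A\<in>Pow {..<N}. norm_L2_sphere (f A) powr q)"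
      using v_pos by (simp add: mult_ac)
    \<comment> \<open>The splitting level is \<open>N\<close>, the mean of the squared norms up to
      the factor \<open>s\<close>.\<close>
    have "(\<Sum>A\<in>Pow {..<N}. norm_L2_sphere (f A) powr q)
        \<le> (\<Sum>A\<in>Pow {..<N}. real N powr (q / 2) + real N powr (q / 2 - 1) * (norm_L2_sphere (f A))\<^sup>2)"
      using N q_pos assms by (intro sum_mono powr_le_split) (auto simp: norm_L2_sphere_def intro!: integral_nonneg_AE)
    also have "\<dots> = 2 ^ N * (real N powr (q / 2) + real N powr (q / 2 - 1) * (real N * s))"
      unfolding sum.distrib sum_distrib_left[symmetric] norm_f by (simp add: card_Pow algebra_simps)
    also have "real N powr (q / 2 - 1) * (real N * s) = real N powr (q / 2) * s"
      using N by (simp add: powr_diff)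
    finally have "C * R powr \<epsilon> * (\<Sum>A\<in>Pow {..<N}. norm_L2_sphere (f A) powr q)
        \<le> C * R powr \<epsilon> * (2 ^ N * (real N powr (q / 2) + real N powr (q / 2) * s))"
      using C_nonneg by (intro mult_left_mono) auto
    with BN have "B * real N \<le> C * R powr \<epsilon> * (2 ^ N * (real N powr (q / 2) + real N powr (q / 2) * s))"
      by (rule order_trans)
    moreover have "B * real N = 2 ^ N * ((s / 2) powr q / 2 * real N)"
      by (simp add: B_def)
    moreover have "C * R powr \<epsilon> * (2 ^ N * (real N powr (q / 2) + real N powr (q / 2) * s))
        = 2 ^ N * (C * R powr \<epsilon> * (real N powr (q / 2) * (1 + s)))"
      by (simp add: algebra_simps)
    ultimately have "2 ^ N * ((s / 2) powr q / 2 * real N) \<le> 2 ^ N * (C * R powr \<epsilon> * (real N powr (q / 2) * (1 + s)))"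
      by simp
    then have "(s / 2) powr q / 2 * real N \<le> C * R powr \<epsilon> * (real N powr (q / 2) * (1 + s))"
      by (rule mult_left_le_imp_le) simp
    moreover have "R powr \<epsilon> = 4 powr \<epsilon> * real N powr ((1 + 1 / \<alpha>) * \<epsilon>)"
    proof -
      have "R = 4 * real N powr (1 + 1 / \<alpha>)" using N by (simp add: R_def L_def powr_add)
      then show ?thesis by (simp add: powr_mult powr_powr)
    qed
    ultimately have "(s / 2) powr q / 2 * real N
        \<le> C * 4 powr \<epsilon> * (1 + s) * real N powr ((1 + 1 / \<alpha>) * \<epsilon> + q / 2)"
      by (simp add: powr_add mult_ac)
    then show "real N powr 1 \<le> K * real N powr ((1 + 1 / \<alpha>) * \<epsilon> + q / 2)"
      using s N by (simp add: K_def field_simps)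
  qed
qed

end

section \<open>Removal of the epsilon loss and the case distinction\<close>

theorem theorem2p2:
  fixes \<alpha> q :: real
  assumes "CARD('n) \<ge> 2"
    and "0 < \<alpha>" and "\<alpha> \<le> real CARD('n)"
    and "q > 0"
    and "\<forall>\<epsilon>>0. \<exists>C\<ge>0::real. \<forall>f\<in>L2_sphere. \<forall>H :: real ^ 'n \<Rightarrow> real. \<forall>R\<ge>1.
           weight_of_dim \<alpha> H \<longrightarrow>
             (\<integral>\<^sup>+x\<in>cball 0 R. ennreal (norm (extension_op f x) powr q * H x) \<partial>lebesgue)
               \<le> ennreal (C * R powr \<epsilon>) * A_dim \<alpha> H * ennreal (norm_L2_sphere f powr q)"
  shows "(CARD('n) \<ge> 3 \<and> \<alpha> \<le> real CARD('n) - 2 \<longrightarrow> q \<ge> 2) \<and>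
         (CARD('n) \<ge> 3 \<and> real CARD('n) - 2 < \<alpha> \<or> CARD('n) = 2 \<and> 1 < \<alpha>
            \<longrightarrow> q \<ge> (2 * \<alpha> + 2) / (real CARD('n) - 1)) \<and>
         (CARD('n) = 2 \<and> \<alpha> < 1 / 2 \<longrightarrow> q \<ge> 2) \<and>
         (CARD('n) = 2 \<and> 1 / 2 \<le> \<alpha> \<and> \<alpha> \<le> 1 \<longrightarrow> q \<ge> 4 * \<alpha>)"
proof -
  let ?n = "real CARD('n)"
  have loc: "\<exists>C. weighted_restriction TYPE('n) \<alpha> q \<epsilon> C" if "\<epsilon> > 0" for \<epsilon>
  proof -
    from assms(5) that obtain C where "C \<ge> 0" and "\<forall>f\<in>L2_sphere. \<forall>H :: real ^ 'n \<Rightarrow> real. \<forall>R\<ge>1.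
           weight_of_dim \<alpha> H \<longrightarrow>
             (\<integral>\<^sup>+x\<in>cball 0 R. ennreal (norm (extension_op f x) powr q * H x) \<partial>lebesgue)
               \<le> ennreal (C * R powr \<epsilon>) * A_dim \<alpha> H * ennreal (norm_L2_sphere f powr q)"
      by blast
    then have "weighted_restriction TYPE('n) \<alpha> q \<epsilon> C"
      using assms(2,4) by unfold_locales blast+
    then show ?thesis ..
  qed
  have large: "(\<alpha> + 1) / 2 \<le> q * (?n - 1) / 4" if "1 \<le> \<alpha>"
  proof (rule field_le_epsilon)
    fix \<epsilon> :: real assume "\<epsilon> > 0"
    with loc obtain C where "weighted_restriction TYPE('n) \<alpha> q \<epsilon> C" by blast
    from weighted_restriction.knapp_exponent_large[OF this that assms(3)]
    show "(\<alpha> + 1) / 2 \<le> q * (?n - 1) / 4 + \<epsilon>" by simp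
  qed
  have small: "\<alpha> \<le> q * (?n - 1) / 4" if "\<alpha> \<le> 1"
  proof (rule field_le_epsilon)
    fix \<epsilon> :: real assume "\<epsilon> > 0"
    with loc obtain C where "weighted_restriction TYPE('n) \<alpha> q \<epsilon> C" by blast
    from weighted_restriction.knapp_exponent_small[OF this that]
    show "\<alpha> \<le> q * (?n - 1) / 4 + \<epsilon>" by simp
  qed
  have two: "q \<ge> 2"
  proof (rule ccontr)
    assume "\<not> q \<ge> 2"
    have "1 \<le> q / 2"
    proof (rule field_le_epsilon)
      fix \<delta> :: real assume "\<delta> > 0"
      \<comment> \<open>This value of epsilon makes the loss in \<open>sparse_exponent\<close>
        exactly \<open>\<delta>\<close>.\<close>
      then have "\<delta> / (1 + 1 / \<alpha>) > 0" using assms(2) by (simp add: add_pos_pos)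
      with loc obtain C where "weighted_restriction TYPE('n) \<alpha> q (\<delta> / (1 + 1 / \<alpha>)) C" by blast
      from weighted_restriction.sparse_exponent[OF this] \<open>\<not> q \<ge> 2\<close>
      have "1 \<le> (1 + 1 / \<alpha>) * (\<delta> / (1 + 1 / \<alpha>)) + q / 2" by simp
      moreover have "(1 + 1 / \<alpha>) * (\<delta> / (1 + 1 / \<alpha>)) = \<delta>"
        using assms(2) add_pos_pos[of 1 "1 / \<alpha>"] by simp
      ultimately show "1 \<le> q / 2 + \<delta>" by simp
    qed
    with \<open>\<not> q \<ge> 2\<close> show False by simp
  qed
  \<comment> \<open>The bound \<open>two\<close> holds throughout; each case of the claim names the
    larger of it and the Knapp bound for that range.\<close>
  have "q \<ge> (2 * \<alpha> + 2) / (?n - 1)" if "\<alpha> \<ge> 1"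
    using large[OF that] assms(1) by (simp add: divide_simps)
  moreover have "q \<ge> 4 * \<alpha>" if "\<alpha> \<le> 1" "CARD('n) = 2"
    using small[OF that(1)] that(2) by simp
  moreover have "\<alpha> \<ge> 1" if "CARD('n) \<ge> 3 \<and> ?n - 2 < \<alpha> \<or> CARD('n) = 2 \<and> 1 < \<alpha>"
    using that by auto
  ultimately show ?thesis using two by auto
qed

end
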